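(* Let $n\ge 4$. The only points $(s,t)\in\mathcal{L}_{n,2}$ at which the minimum $$\mu_{n,2}^{\operatorname{tr}}=\min\{s+t : (s,t)\in\mathcal{L}_{n,2}\}$$ is attained are $(s,t)=\left(0,\tfrac{3-n}{2}\right)$ and $(s,t)=\left(\tfrac{3-n}{2},0\right)$. In particular, the sets $\mathcal{L}_{n,2}$ and $\lambda(\mathcal{S}^{n,2})$ are not convex.
   Context: $\mathcal{S}^{n,2}$ is the set of real symmetric $n\times n$ matrices all of whose $2\times 2$ principal submatrices are positive semidefinite. $\lambda(\mathcal{S}^{n,2})$ is the set of all $(\lambda_1,\dots,\lambda_n)\in\mathbb{R}^n$ such that some $X\in\mathcal{S}^{n,2}$ is similar to $\operatorname{diag}(\lambda_1,\dots,\lambda_n)$. $\mathcal{L}_{n,2}:=\{(s,t)\in\mathbb{R}^2 : (1,\dots,1,s,t)\in\lambda(\mathcal{S}^{n,2})\}$ (with $n-2$ ones). *)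

theory Defs
  imports "HOL-Analysis.Analysis"
begin

definition psd_matrix :: "real^'k^'k \<Rightarrow> bool" where
  "psd_matrix A \<longleftrightarrow> transpose A = A \<and> (\<forall>x. 0 \<le> x \<bullet> (A *v x))"

text \<open>The principal submatrix on the rows and columns \<open>range f\<close>, for an injection \<open>f\<close> of the
  small index type into the large one. Injections with the same range give the same principal
  submatrix up to a simultaneous permutation of rows and columns.\<close>

definition principal_submatrix :: "('k \<Rightarrow> 'n) \<Rightarrow> real^'n^'n \<Rightarrow> real^'k^'k" where
  "principal_submatrix f A = (\<chi> a b. A $ f a $ f b)"

text \<open>The set \<open>S\<^bsup>n,2\<^esup>\<close> with \<open>n = CARD('n)\<close>; the index type \<open>2\<close> is the two-element numeral type.\<close>

definition S2 :: "(real^'n^'n) set" where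
  "S2 = {X. transpose X = X \<and>
            (\<forall>f :: 2 \<Rightarrow> 'n. inj f \<longrightarrow> psd_matrix (principal_submatrix f X))}"

definition diag_matrix :: "real^'n \<Rightarrow> real^'n^'n" where
  "diag_matrix d = (\<chi> i j. if i = j then d $ i else 0)"

definition similar_matrix :: "real^'n^'n \<Rightarrow> real^'n^'n \<Rightarrow> bool" where
  "similar_matrix A B \<longleftrightarrow> (\<exists>P. invertible P \<and> A = P ** B ** matrix_inv P)"

definition eigenvalue_vectors :: "(real^'n^'n) set \<Rightarrow> (real^'n) set" where
  "eigenvalue_vectors M = {l. \<exists>X\<in>M. similar_matrix X (diag_matrix l)}"

text \<open>The vector \<open>(1, \<dots>, 1, s, t)\<close>. The coordinates are listed in the order of the index type,
  so \<open>card {j. i < j}\<close> is the number of coordinates after the one at \<open>i\<close>.\<close>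

definition ones_then :: "real \<Rightarrow> real \<Rightarrow> (real, 'n::{finite,linorder}) vec" where
  "ones_then s t = (\<chi> i. if card {j. i < j} = 0 then t
                         else if card {j. i < j} = 1 then s else 1)"

text \<open>The set \<open>L\<^bsub>n,2\<^esub>\<close>; the \<open>itself\<close> argument only carries the index type, that is, \<open>n = CARD('n)\<close>.\<close>

definition L2 :: "'n::{finite,linorder} itself \<Rightarrow> (real \<times> real) set" where
  "L2 _ = {(s, t). (ones_then s t :: (real, 'n) vec) \<in> eigenvalue_vectors S2}"

end

theory Submission
  imports Defs
begin

text \<open>
  Write \<open>n\<close> for the size and let \<open>X\<close> in \<open>S2\<close> have the eigenvalues \<open>1, \<dots>, 1, s, t\<close>. Summing the
  conditions \<open>x\<^sub>i\<^sub>j\<^sup>2 \<le> x\<^sub>i\<^sub>i x\<^sub>j\<^sub>j\<close> over all entries gives \<open>tr (X\<^sup>2) \<le> (tr X)\<^sup>2\<close>, which says that the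
  second elementary symmetric function of the eigenvalues is nonnegative. If \<open>s t \<le> 0\<close>, this already
  yields \<open>s + t \<ge> (3 - n)/2\<close>, with equality only for \<open>s t = 0\<close>
  (\<open>trace_lower_bound_nonpos_prod\<close>). If \<open>s\<close> and \<open>t\<close> are both positive there is nothing to show, because
  the bound is negative. The bound is attained by the matrix that is zero in one row and column and is
  \<open>I - J/2\<close> on the others, where \<open>J\<close> is the all-ones matrix (\<open>minimizer_mem\<close>). Two distinct minimizers
  of a linear function, without their midpoint, rule out convexity.

  The hard case is that \<open>s\<close> and \<open>t\<close> are both negative. The trace inequality is then too weak: for
  \<open>n = 4\<close> it allows \<open>s = t = \<surd>3 - 2\<close>, with a sum below \<open>-1/2\<close>. But now \<open>I - X\<close> is positive
  semidefinite of rank two, hence the Gram matrix of vectors \<open>w\<^sub>1, \<dots>, w\<^sub>n\<close> in the plane, whose second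
  moment matrix is \<open>diag (1 - s, 1 - t)\<close>. With \<open>p\<^sub>i = |w\<^sub>i|\<^sup>2\<close>, membership in \<open>S2\<close> says \<open>p\<^sub>i \<le> 1\<close> and
  \<open>p\<^sub>i + p\<^sub>j \<le> 1 + det(w\<^sub>i, w\<^sub>j)\<^sup>2\<close>, and the claim becomes \<open>p\<^sub>1 + \<dots> + p\<^sub>n < (n + 1)/2\<close>
  (\<open>spread_trace_lt\<close>).

  The inequality constrains only the long vectors, those with \<open>p\<^sub>i > 1/2\<close>; every other vector
  contributes at most \<open>1/2\<close>. Three vectors contribute at most \<open>2\<close>, by the trace argument
  (\<open>spread_triple\<close>), so if there are at most three long vectors the non-strict bound follows, and
  equality would force either \<open>1 - s = 1\<close> or \<open>1 - t = 1\<close>. If there are at least four long vectors, the bound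
  is a matter of plane geometry (\<open>sq_len_sum_lt_all_big\<close>): long vectors must point in different
  directions, the excess \<open>(p\<^sub>i - 1/2) + (p\<^sub>j - 1/2)\<close> of two neighbours is controlled by the angle between
  their lines, and the angles between consecutive lines add up to at most \<open>\<pi>\<close>. When all
  \<open>p\<^sub>i \<le> 2/3\<close>, the excess of two neighbours is at most their angle divided by \<open>\<pi>\<close>, and summing around
  the circle of lines gives total excess below \<open>1/2\<close>. When some \<open>p\<^sub>0 > 2/3\<close>, the condition against
  \<open>w\<^sub>0\<close> confines every other vector to an ellipse; after rescaling the ellipse to the unit disc, the
  excess of two neighbours is at most \<open>1 - p\<^sub>0\<close> times the squared sine of their angle, and squared
  sines are superadditive as long as the total angle is at most \<open>\<pi>/2\<close>. For a larger total angle, the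
  two extreme vectors lie so far along the ellipse that their own excess is small enough to make up for the loss.
\<close>

section \<open>The trace bound and the shape of X\<close>

definition two_spec :: "'n \<Rightarrow> 'n \<Rightarrow> real \<Rightarrow> real \<Rightarrow> real^'n" where
  "two_spec k l s t = (\<chi> i. if i = k then t else if i = l then s else 1)"

lemma two_spec_swap: "k \<noteq> l \<Longrightarrow> two_spec l k t s = two_spec k l s t"
  by (auto simp: two_spec_def vec_eq_iff)

text \<open>Only the two positions of \<open>s\<close> and \<open>t\<close> matter for the spectrum, so the order on the index type is
  used here once to locate them.\<close>
lemma ones_then_eq_two_spec:
  assumes "2 \<le> CARD('n::{finite,linorder})"
  shows "\<exists>k l :: 'n. k \<noteq> l \<and> (\<forall>s t. ones_then s t = two_spec k l s t)"
proof -
  define k :: 'n where "k = Max UNIV"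
  have kmax: "i \<le> k" for i by (simp add: k_def)
  have ne: "UNIV - {k} \<noteq> {}"
  proof
    assume "UNIV - {k} = {}"
    then have "(UNIV :: 'n set) = {k}" by auto
    then have "CARD('n) = card {k}" by (rule arg_cong)
    then show False using assms by simp
  qed
  define l where "l = Max (UNIV - {k})"
  have l: "l \<noteq> k" using Max_in[OF _ ne] by (auto simp: l_def)
  have lmax: "i \<le> l" if "i \<noteq> k" for i using that by (simp add: l_def)
  have c0: "card {j. i < j} = 0 \<longleftrightarrow> i = k" for i
  proof -
    have "card {j. i < j} = 0 \<longleftrightarrow> (\<forall>j. j \<le> i)" by (auto simp: not_less)
    then show ?thesis using kmax by (metis antisym)
  qed
  have c1: "card {j. i < j} = 1 \<longleftrightarrow> i = l" for i
  proof
    assume "i = l"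
    then have "{j. i < j} = {k}" using l lmax kmax
      by (auto simp: order.strict_iff_order) (metis antisym lmax)
    then show "card {j. i < j} = 1" by simp
  next
    assume one: "card {j. i < j} = 1"
    show "i = l"
    proof (rule ccontr)
      assume "i \<noteq> l"
      have "i \<noteq> k" using one c0[of i] by auto
      then have "{k, l} \<subseteq> {j. i < j}" using \<open>i \<noteq> l\<close> kmax lmax by (auto simp: order.strict_iff_order)
      from card_mono[OF _ this] show False using one l by simp
    qed
  qed
  have "ones_then s t = two_spec k l s t" for s t
    unfolding ones_then_def two_spec_def c0 c1 ..
  then show ?thesis using l by (intro exI[of _ k] exI[of _ l]) auto
qed

lemma sum_two_spec:
  fixes k l :: "'n::finite" and f :: "real \<Rightarrow> real"
  assumes "k \<noteq> l"
  shows "(\<Sum>i\<in>UNIV. f (two_spec k l s t $ i)) = f s + f t + (real CARD('n) - 2) * f 1"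
proof -
  have "(\<Sum>i\<in>UNIV. f (two_spec k l s t $ i))
      = (\<Sum>i\<in>UNIV. f 1 + (if i = k then f t - f 1 else 0) + (if i = l then f s - f 1 else 0))"
    using assms by (intro sum.cong) (auto simp: two_spec_def)
  also have "\<dots> = f s + f t + (real CARD('n) - 2) * f 1"
    by (simp add: sum.distrib algebra_simps)
  finally show ?thesis .
qed

lemma symmetric_entry:
  fixes X :: "real^'n^'n"
  assumes "transpose X = X"
  shows "X$i$j = X$j$i"
proof -
  have "X$i$j = transpose X$i$j" using assms by simp
  then show ?thesis by (simp add: transpose_def)
qed

text \<open>The off-diagonal condition comes from testing the form on the vector \<open>(c, -b)\<close>, or, when the
  lower diagonal entry \<open>c\<close> vanishes, on a vector that makes the mixed term dominate.\<close>
lemma psd_matrix_2_iff: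
  fixes A :: "real^2^2"
  shows "psd_matrix A \<longleftrightarrow>
    A$1$2 = A$2$1 \<and> 0 \<le> A$1$1 \<and> 0 \<le> A$2$2 \<and> (A$1$2)\<^sup>2 \<le> A$1$1 * A$2$2"
proof
  assume psd: "psd_matrix A"
  then have sym: "A$1$2 = A$2$1" by (intro symmetric_entry) (simp add: psd_matrix_def)
  define a b c where "a = A$1$1" and "b = A$1$2" and "c = A$2$2"
  have q: "0 \<le> a * p\<^sup>2 + 2 * b * p * r + c * r\<^sup>2" for p r
  proof -
    have "0 \<le> (vector [p, r] :: real^2) \<bullet> (A *v vector [p, r])"
      using psd by (simp add: psd_matrix_def)
    also have "\<dots> = a * p\<^sup>2 + 2 * b * p * r + c * r\<^sup>2"
      using sym by (simp add: inner_vec_def matrix_vector_mult_def sum_2 a_def b_def c_def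
          power2_eq_square algebra_simps)
    finally show ?thesis .
  qed
  have a: "0 \<le> a" using q[of 1 0] by simp
  have c: "0 \<le> c" using q[of 0 1] by simp
  have "b\<^sup>2 \<le> a * c"
  proof (cases "c = 0")
    case True
    have "a * b\<^sup>2 + 2 * b * b * (- (a + 1) / 2) + c * (- (a + 1) / 2)\<^sup>2 = - b\<^sup>2"
      using True by (simp add: field_simps power2_eq_square)
    then show ?thesis using q[of b "- (a + 1) / 2"] True by simp
  next
    case False
    have "a * c\<^sup>2 + 2 * b * c * (- b) + c * (- b)\<^sup>2 = c * (a * c - b\<^sup>2)" by algebra
    then have "0 \<le> c * (a * c - b\<^sup>2)" using q[of c "- b"] by simp
    then show ?thesis using False c by (simp add: zero_le_mult_iff)
  qed
  then show "A$1$2 = A$2$1 \<and> 0 \<le> A$1$1 \<and> 0 \<le> A$2$2 \<and> (A$1$2)\<^sup>2 \<le> A$1$1 * A$2$2"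
    using a c sym by (simp add: a_def b_def c_def)
next
  assume h: "A$1$2 = A$2$1 \<and> 0 \<le> A$1$1 \<and> 0 \<le> A$2$2 \<and> (A$1$2)\<^sup>2 \<le> A$1$1 * A$2$2"
  define a b c where "a = A$1$1" and "b = A$1$2" and "c = A$2$2"
  have abc: "0 \<le> a" "0 \<le> c" "b\<^sup>2 \<le> a * c" "A$2$1 = b" using h by (auto simp: a_def b_def c_def)
  have q: "0 \<le> a * p\<^sup>2 + 2 * b * p * r + c * r\<^sup>2" for p r
  proof (cases "a = 0")
    case True
    then show ?thesis using abc by simp
  next
    case False
    have "a * (a * p\<^sup>2 + 2 * b * p * r + c * r\<^sup>2) = (a * p + b * r)\<^sup>2 + (a * c - b\<^sup>2) * r\<^sup>2"
      by algebra
    moreover have "0 \<le> (a * p + b * r)\<^sup>2 + (a * c - b\<^sup>2) * r\<^sup>2" using abc by simp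
    ultimately have "0 \<le> a * (a * p\<^sup>2 + 2 * b * p * r + c * r\<^sup>2)" by simp
    then show ?thesis using False abc(1) by (simp add: zero_le_mult_iff)
  qed
  have "x \<bullet> (A *v x) = a * (x$1)\<^sup>2 + 2 * b * x$1 * x$2 + c * (x$2)\<^sup>2" for x
    using abc(4) by (simp add: inner_vec_def matrix_vector_mult_def sum_2 a_def b_def c_def
          power2_eq_square algebra_simps)
  then show "psd_matrix A"
    using q h by (auto simp: psd_matrix_def transpose_def vec_eq_iff forall_2)
qed

lemma mem_S2_iff:
  fixes X :: "real^'n^'n"
  assumes "2 \<le> CARD('n)"
  shows "X \<in> S2 \<longleftrightarrow> transpose X = X \<and> (\<forall>i. 0 \<le> X$i$i) \<and>
    (\<forall>i j. i \<noteq> j \<longrightarrow> (X$i$j)\<^sup>2 \<le> X$i$i * X$j$j)"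
proof
  assume X: "X \<in> S2"
  have minor: "0 \<le> X$i$i \<and> (X$i$j)\<^sup>2 \<le> X$i$i * X$j$j" if "i \<noteq> j" for i j
  proof -
    define f :: "2 \<Rightarrow> 'n" where "f = (\<lambda>a. if a = 1 then i else j)"
    have "inj f" using that by (simp add: inj_def f_def forall_2)
    then have "psd_matrix (principal_submatrix f X)" using X by (simp add: S2_def)
    then show ?thesis by (auto simp: psd_matrix_2_iff principal_submatrix_def f_def)
  qed
  moreover have "\<exists>j. i \<noteq> j" for i :: 'n
  proof (rule ccontr)
    assume "\<nexists>j. i \<noteq> j"
    then have "(UNIV :: 'n set) = {i}" by auto
    then have "CARD('n) = card {i}" by (rule arg_cong)
    then show False using assms by simp
  qed
  ultimately have "0 \<le> X$i$i" for i by metis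
  moreover have "transpose X = X" using X by (simp add: S2_def)
  ultimately show "transpose X = X \<and> (\<forall>i. 0 \<le> X$i$i) \<and>
    (\<forall>i j. i \<noteq> j \<longrightarrow> (X$i$j)\<^sup>2 \<le> X$i$i * X$j$j)"
    using minor by simp
next
  assume h: "transpose X = X \<and> (\<forall>i. 0 \<le> X$i$i) \<and> (\<forall>i j. i \<noteq> j \<longrightarrow> (X$i$j)\<^sup>2 \<le> X$i$i * X$j$j)"
  then have sym: "X$i$j = X$j$i" for i j by (intro symmetric_entry) simp
  have "psd_matrix (principal_submatrix f X)" if "inj f" for f :: "2 \<Rightarrow> 'n"
  proof -
    have "f 1 \<noteq> f 2" using injD[OF that, of 1 2] by auto
    then have "(X $ f 1 $ f 2)\<^sup>2 \<le> X $ f 1 $ f 1 * X $ f 2 $ f 2" using h by blast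
    then show ?thesis
      using h sym[of "f 1" "f 2"] by (simp add: psd_matrix_2_iff principal_submatrix_def)
  qed
  then show "X \<in> S2" using h by (simp add: S2_def)
qed

lemma matrix_inv_mult:
  fixes P :: "real^'n^'n"
  assumes "invertible P"
  shows "P ** matrix_inv P = mat 1" "matrix_inv P ** P = mat 1"
  using someI_ex[OF assms[unfolded invertible_def]] by (simp_all add: matrix_inv_def)

lemma similar_matrix_mult:
  fixes X Y D :: "real^'n^'n"
  assumes "invertible P" "X = P ** D ** matrix_inv P"
  shows "X ** X = P ** (D ** D) ** matrix_inv P" "X ** P = P ** D"
proof -
  have "matrix_inv P ** P = mat 1" by (rule matrix_inv_mult[OF assms(1)])
  then have c: "matrix_inv P ** (P ** Z) = Z" for Z :: "real^'n^'n" by (simp add: matrix_mul_assoc)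
  show "X ** X = P ** (D ** D) ** matrix_inv P" "X ** P = P ** D"
    unfolding assms(2) using c \<open>matrix_inv P ** P = mat 1\<close>
    by (simp_all add: matrix_mul_assoc[symmetric])
qed

lemma trace_conjugate:
  fixes D P :: "real^'n^'n"
  assumes "invertible P"
  shows "trace (P ** D ** matrix_inv P) = trace D"
  using assms by (metis matrix_inv_mult(2) matrix_mul_assoc matrix_mul_rid trace_mul_sym)

text \<open>Both sides are traces, of \<open>X\<^sup>2\<close> and of \<open>X\<close> squared; the inequality is the sum over all
  \<open>i\<close> and \<open>j\<close> of the nonnegativity of the principal \<open>2 \<times> 2\<close> minors.\<close>
lemma sum_squares_eigenvalues_le:
  fixes l :: "real^'n"
  assumes n: "2 \<le> CARD('n)" and l: "l \<in> eigenvalue_vectors S2"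
  shows "(\<Sum>i\<in>UNIV. (l$i)\<^sup>2) \<le> (\<Sum>i\<in>UNIV. l$i)\<^sup>2"
proof -
  obtain X where X: "X \<in> S2" and sim: "similar_matrix X (diag_matrix l)"
    using l unfolding eigenvalue_vectors_def by blast
  obtain P where P: "invertible P" "X = P ** diag_matrix l ** matrix_inv P"
    using sim unfolding similar_matrix_def by blast
  have tr: "(\<Sum>i\<in>UNIV. X$i$i) = (\<Sum>i\<in>UNIV. l$i)"
  proof -
    have "trace X = trace (diag_matrix l)" unfolding P(2) by (rule trace_conjugate[OF P(1)])
    then show ?thesis by (simp add: trace_def diag_matrix_def)
  qed
  have "trace (X ** X) = trace (diag_matrix l ** diag_matrix l)"
    using trace_conjugate[OF P(1)] similar_matrix_mult(1)[OF P] by simp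
  also have "\<dots> = (\<Sum>i\<in>UNIV. (l$i)\<^sup>2)"
    by (simp add: trace_def diag_matrix_def matrix_matrix_mult_def power2_eq_square
        if_distrib cong: if_cong)
  finally have "(\<Sum>i\<in>UNIV. (l$i)\<^sup>2) = (\<Sum>i\<in>UNIV. \<Sum>j\<in>UNIV. X$i$j * X$j$i)"
    by (simp add: trace_def matrix_matrix_mult_def)
  also have "\<dots> \<le> (\<Sum>i\<in>UNIV. \<Sum>j\<in>UNIV. X$i$i * X$j$j)"
  proof (intro sum_mono)
    fix i j
    have "X$j$i = X$i$j" using X by (intro symmetric_entry) (simp add: S2_def)
    then show "X$i$j * X$j$i \<le> X$i$i * X$j$j"
      using X mem_S2_iff[OF n, of X] by (cases "i = j") (auto simp: power2_eq_square)
  qed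
  also have "\<dots> = (\<Sum>i\<in>UNIV. X$i$i)\<^sup>2"
    by (simp add: power2_eq_square sum_product)
  finally show ?thesis using tr by simp
qed

lemma symmetric_inner:
  fixes X :: "real^'n^'n"
  assumes "transpose X = X"
  shows "(X *v p) \<bullet> q = p \<bullet> (X *v q)"
  by (metis assms dot_lmul_matrix transpose_matrix_vector)

lemma symmetric_eigenvectors_orthogonal:
  fixes X :: "real^'n^'n"
  assumes "transpose X = X" "X *v p = a *\<^sub>R p" "X *v q = b *\<^sub>R q" "a \<noteq> b"
  shows "p \<bullet> q = 0"
  using symmetric_inner[OF assms(1), of p q] assms by simp

text \<open>The part of the spectral theorem that is needed: a similar diagonal matrix supplies eigenvectors,
  one Gram--Schmidt step inside the eigenspace makes the two special ones orthogonal when \<open>s = t\<close>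
  (for \<open>s \<noteq> t\<close> they already are), and symmetry makes the eigenvalue-1 vectors orthogonal to both.
  So \<open>X - I\<close> is determined by these two vectors.\<close>
lemma spectral_form:
  fixes X :: "real^'n^'n"
  assumes kl: "k \<noteq> l" and sym: "transpose X = X" and st: "s \<noteq> 1" "t \<noteq> 1"
    and sim: "similar_matrix X (diag_matrix (two_spec k l s t))"
  shows "\<exists>u v. u \<bullet> u = 1 \<and> v \<bullet> v = 1 \<and> u \<bullet> v = 0 \<and>
    (\<forall>i j. X$i$j = (if i = j then 1 else 0) - (1 - s) * u$i * u$j - (1 - t) * v$i * v$j)"
proof -
  obtain P where P: "invertible P" "X = P ** diag_matrix (two_spec k l s t) ** matrix_inv P"
    using sim unfolding similar_matrix_def by blast
  define c where "c i = P *v axis i 1" for i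
  have inj: "w = 0" if "P *v w = 0" for w
    using P(1) that by (metis matrix_inv_mult(2) matrix_vector_mul_assoc matrix_vector_mul_lid
        matrix_vector_mult_0_right)
  have eig: "X *v c i = (two_spec k l s t $ i) *\<^sub>R c i" for i
  proof -
    have "diag_matrix (two_spec k l s t) *v axis i 1 = (two_spec k l s t $ i) *\<^sub>R axis i 1"
      unfolding matrix_vector_mult_basis
      by (simp add: column_def vec_eq_iff diag_matrix_def axis_def)
    then show ?thesis
      unfolding c_def by (simp add: matrix_vector_mul_assoc similar_matrix_mult(2)[OF P])
        (simp add: matrix_vector_mul_assoc[symmetric] matrix_vector_mult_scaleR)
  qed
  define f where "f = c l"
  define r where "r = (c k \<bullet> f) / (f \<bullet> f)"
  define g where "g = c k - r *\<^sub>R f"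
  have Xf: "X *v f = s *\<^sub>R f" using eig[of l] kl by (simp add: f_def two_spec_def)
  have Xk: "X *v c k = t *\<^sub>R c k" using eig[of k] by (simp add: two_spec_def)
  have f0: "f \<noteq> 0"
    using inj[of "axis l 1"] by (auto simp: f_def c_def axis_eq_0_iff)
  have g0: "g \<noteq> 0"
  proof
    assume "g = 0"
    then have "P *v (axis k 1 - r *\<^sub>R axis l 1) = 0"
      by (simp add: g_def f_def c_def matrix_vector_mult_diff_distrib matrix_vector_mult_scaleR)
    then have "axis k 1 - r *\<^sub>R axis l 1 = (0 :: real^'n)" by (rule inj)
    then have "(axis k 1 - r *\<^sub>R axis l 1 :: real^'n) $ k = 0" by simp
    then show False using kl by (simp add: axis_def)
  qed
  have fg: "f \<bullet> g = 0" using f0 by (simp add: g_def r_def inner_diff_right inner_commute)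
  have Xg: "X *v g = t *\<^sub>R g"
  proof (cases "s = t")
    case True
    then show ?thesis
      by (simp add: g_def matrix_vector_mult_diff_distrib matrix_vector_mult_scaleR Xf Xk
          scaleR_diff_right)
  next
    case False
    then have "r = 0"
      using symmetric_eigenvectors_orthogonal[OF sym Xk Xf] by (simp add: r_def)
    then show ?thesis by (simp add: g_def Xk)
  qed
  define u v where "u = (1 / norm f) *\<^sub>R f" and "v = (1 / norm g) *\<^sub>R g"
  have uv: "u \<bullet> u = 1" "v \<bullet> v = 1" "u \<bullet> v = 0"
    using f0 g0 fg by (simp_all add: u_def v_def dot_square_norm power2_eq_square)
  have fu: "f = norm f *\<^sub>R u" and gv: "g = norm g *\<^sub>R v" using f0 g0 by (simp_all add: u_def v_def)
  \<comment> \<open>\<open>N\<close> is the difference of the two sides; it kills every column of the invertible matrix \<open>P\<close>.\<close>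
  define N :: "real^'n^'n" where
    "N = (\<chi> i j. X$i$j - (if i = j then 1 else 0) + (1 - s) * u$i * u$j + (1 - t) * v$i * v$j)"
  have N: "N *v z = X *v z - z + ((1 - s) * (u \<bullet> z)) *\<^sub>R u + ((1 - t) * (v \<bullet> z)) *\<^sub>R v" for z
  proof -
    have entry: "(N *v z) $ i = (\<Sum>j\<in>UNIV. X$i$j * z$j - (if i = j then z$j else 0)
        + (1 - s) * u$i * (u$j * z$j) + (1 - t) * v$i * (v$j * z$j))" for i
      by (auto simp: N_def matrix_vector_mult_def algebra_simps intro!: sum.cong)
    have "(N *v z) $ i = (X *v z) $ i - z$i + (1 - s) * u$i * (u \<bullet> z) + (1 - t) * v$i * (v \<bullet> z)" for i
      unfolding entry
      by (simp add: sum.distrib sum_subtractf sum_distrib_left[symmetric]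
          matrix_vector_mult_def inner_vec_def)
    then show ?thesis by (simp add: vec_eq_iff mult_ac)
  qed
  have Nu: "N *v u = 0"
    unfolding N using Xf uv by (simp add: u_def[symmetric] inner_commute[of v u] scaleR_left_diff_distrib)
      (simp add: u_def matrix_vector_mult_scaleR)
  have Nv: "N *v v = 0"
    unfolding N using Xg uv by (simp add: v_def[symmetric] inner_commute[of v u] scaleR_left_diff_distrib)
      (simp add: v_def matrix_vector_mult_scaleR)
  have Nc: "N *v c i = 0" for i
  proof -
    consider "i = l" | "i = k" | "i \<noteq> k" "i \<noteq> l" by blast
    then show ?thesis
    proof cases
      case 1
      then have "c i = norm f *\<^sub>R u" using fu by (simp add: f_def)
      then show ?thesis using Nu by (simp add: matrix_vector_mult_scaleR)
    next
      case 2
      then have "c i = norm g *\<^sub>R v + (r * norm f) *\<^sub>R u"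
        using fu gv by (simp add: g_def) (metis diff_add_cancel scaleR_scaleR)
      then show ?thesis using Nu Nv by (simp add: matrix_vector_right_distrib matrix_vector_mult_scaleR)
    next
      case 3
      then have Xc: "X *v c i = 1 *\<^sub>R c i" using eig[of i] by (simp add: two_spec_def)
      have "f \<bullet> c i = 0" "g \<bullet> c i = 0"
        using symmetric_eigenvectors_orthogonal[OF sym Xf Xc]
          symmetric_eigenvectors_orthogonal[OF sym Xg Xc] st by auto
      then show ?thesis unfolding N using Xc by (simp add: u_def v_def)
    qed
  qed
  have "N ** P = 0"
  proof -
    have "column i (N ** P) = 0" for i
      using Nc[of i] unfolding c_def matrix_vector_mult_basis[symmetric] matrix_vector_mul_assoc .
    then show ?thesis by (simp add: column_def vec_eq_iff)
  qed
  then have "N ** P ** matrix_inv P = 0" by (simp add: matrix_matrix_mult_def vec_eq_iff)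
  then have "N = 0" by (simp add: matrix_mul_assoc[symmetric] matrix_inv_mult(1)[OF P(1)])
  have "X$i$j = (if i = j then 1 else 0) - (1 - s) * u$i * u$j - (1 - t) * v$i * v$j" for i j
  proof -
    have "N $ i $ j = 0" using \<open>N = 0\<close> by simp
    then show ?thesis by (auto simp: N_def)
  qed
  then show ?thesis using uv by blast
qed

section \<open>Plane vectors with large pairwise determinants\<close>

definition sq_len :: "('i \<Rightarrow> real) \<Rightarrow> ('i \<Rightarrow> real) \<Rightarrow> 'i \<Rightarrow> real" where
  "sq_len x y i = (x i)\<^sup>2 + (y i)\<^sup>2"

definition cross :: "('i \<Rightarrow> real) \<Rightarrow> ('i \<Rightarrow> real) \<Rightarrow> 'i \<Rightarrow> 'i \<Rightarrow> real" where
  "cross x y i j = x i * y j - x j * y i"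

text \<open>By Lagrange's identity the pairwise condition is \<open>(w\<^sub>i \<bullet> w\<^sub>j)\<^sup>2 \<le> (1 - |w\<^sub>i|\<^sup>2) (1 - |w\<^sub>j|\<^sup>2)\<close> for the
  vectors \<open>w\<^sub>i = (x i, y i)\<close>, that is, nonnegativity of the \<open>2 \<times> 2\<close> principal minors of the identity minus
  their Gram matrix. The determinant form is the one that sees only the angle between two lines.\<close>
definition spread_on :: "'i set \<Rightarrow> ('i \<Rightarrow> real) \<Rightarrow> ('i \<Rightarrow> real) \<Rightarrow> bool" where
  "spread_on A x y \<longleftrightarrow> (\<forall>i\<in>A. sq_len x y i \<le> 1) \<and>
     (\<forall>i\<in>A. \<forall>j\<in>A. i \<noteq> j \<longrightarrow> sq_len x y i + sq_len x y j \<le> 1 + (cross x y i j)\<^sup>2)"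

text \<open>Let \<open>G\<close> be the sum of the matrices \<open>w\<^sub>i w\<^sub>i\<^sup>T\<close> and \<open>S\<close> its trace. By Cauchy--Binet the three squared
  determinants add up to \<open>det G \<le> S\<^sup>2/4\<close>, so the pair conditions give \<open>(S - 2) (S - 6) \<ge> 0\<close>, and
  \<open>S \<le> 3\<close> leaves only \<open>S \<le> 2\<close>. Equality forces equality in every step, in particular \<open>G = I\<close>.\<close>
lemma spread_triple:
  assumes card: "card T = 3" and spread_on: "spread_on T x y"
  shows "(\<Sum>i\<in>T. sq_len x y i) \<le> 2"
    and "(\<Sum>i\<in>T. sq_len x y i) = 2 \<Longrightarrow>
      (\<Sum>i\<in>T. (x i)\<^sup>2) = 1 \<and> (\<Sum>i\<in>T. (y i)\<^sup>2) = 1 \<and> (\<Sum>i\<in>T. x i * y i) = 0 \<and>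
      (\<forall>i\<in>T. \<forall>j\<in>T. i \<noteq> j \<longrightarrow> sq_len x y i + sq_len x y j = 1 + (cross x y i j)\<^sup>2)"
proof -
  obtain a b c where T: "T = {a, b, c}" and ne: "a \<noteq> b" "a \<noteq> c" "b \<noteq> c"
    using card card_3_iff by metis
  define P Q R S where "P = (\<Sum>i\<in>T. (x i)\<^sup>2)" and "Q = (\<Sum>i\<in>T. (y i)\<^sup>2)"
    and "R = (\<Sum>i\<in>T. x i * y i)" and "S = (\<Sum>i\<in>T. sq_len x y i)"
  have S: "S = P + Q" by (simp add: S_def P_def Q_def sq_len_def sum.distrib)
  have exp: "P = (x a)\<^sup>2 + (x b)\<^sup>2 + (x c)\<^sup>2" "Q = (y a)\<^sup>2 + (y b)\<^sup>2 + (y c)\<^sup>2"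
    "R = x a * y a + x b * y b + x c * y c" "S = sq_len x y a + sq_len x y b + sq_len x y c"
    using ne by (simp_all add: P_def Q_def R_def S_def T)
  have gram: "(cross x y a b)\<^sup>2 + (cross x y a c)\<^sup>2 + (cross x y b c)\<^sup>2 = P * Q - R\<^sup>2"
    unfolding exp cross_def by algebra
  have pr: "sq_len x y a + sq_len x y b \<le> 1 + (cross x y a b)\<^sup>2"
    "sq_len x y a + sq_len x y c \<le> 1 + (cross x y a c)\<^sup>2"
    "sq_len x y b + sq_len x y c \<le> 1 + (cross x y b c)\<^sup>2"
    "sq_len x y a \<le> 1" "sq_len x y b \<le> 1" "sq_len x y c \<le> 1"
    using spread_on ne by (auto simp: spread_on_def T)
  have S3: "S \<le> 3" using pr exp by simp
  have main: "2 * S - 3 \<le> P * Q - R\<^sup>2" using pr exp gram by simp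
  have sq: "4 * (P * Q - R\<^sup>2) = S\<^sup>2 - (P - Q)\<^sup>2 - 4 * R\<^sup>2" unfolding S by algebra
  have le2: "S \<le> 2"
  proof (rule ccontr)
    assume "\<not> S \<le> 2"
    then have "(S - 2) * (S - 6) < 0" using S3 by (simp add: mult_less_0_iff)
    moreover have "(S - 2) * (S - 6) = S\<^sup>2 - 8 * S + 12" by algebra
    ultimately have "S\<^sup>2 - 8 * S + 12 < 0" by simp
    moreover have "4 * (2 * S - 3) \<le> S\<^sup>2 - (P - Q)\<^sup>2 - 4 * R\<^sup>2"
      unfolding sq[symmetric] using main by simp
    moreover have "S\<^sup>2 - (P - Q)\<^sup>2 - 4 * R\<^sup>2 \<le> S\<^sup>2"
      using zero_le_power2[of "P - Q"] zero_le_power2[of R] by (smt (verit))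
    ultimately show False by argo
  qed
  then show "(\<Sum>i\<in>T. sq_len x y i) \<le> 2" by (simp add: S_def)
  assume "(\<Sum>i\<in>T. sq_len x y i) = 2"
  then have S2: "S = 2" by (simp add: S_def)
  have PQ: "(P - Q)\<^sup>2 + 4 * R\<^sup>2 \<le> 0" using main sq S2 by simp
  then have z: "P - Q = 0" "R = 0"
    using sum_power2_le_zero_iff[of "P - Q" "2 * R"] by (auto simp: power_mult_distrib)
  then have one: "P = 1" "Q = 1" using S S2 by auto
  have "sq_len x y a + sq_len x y b = 1 + (cross x y a b)\<^sup>2"
    "sq_len x y a + sq_len x y c = 1 + (cross x y a c)\<^sup>2"
    "sq_len x y b + sq_len x y c = 1 + (cross x y b c)\<^sup>2"
    using pr gram exp(4) S2 one z by auto
  moreover have "(cross x y i j)\<^sup>2 = (cross x y j i)\<^sup>2" for i j unfolding cross_def by algebra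
  ultimately have "\<forall>i\<in>T. \<forall>j\<in>T. i \<noteq> j \<longrightarrow> sq_len x y i + sq_len x y j = 1 + (cross x y i j)\<^sup>2"
    unfolding T by (simp add: add.commute)
  then show "(\<Sum>i\<in>T. (x i)\<^sup>2) = 1 \<and> (\<Sum>i\<in>T. (y i)\<^sup>2) = 1 \<and> (\<Sum>i\<in>T. x i * y i) = 0 \<and>
      (\<forall>i\<in>T. \<forall>j\<in>T. i \<noteq> j \<longrightarrow> sq_len x y i + sq_len x y j = 1 + (cross x y i j)\<^sup>2)"
    using one z by (simp add: P_def Q_def R_def)
qed

text \<open>Suppose that a vector \<open>w\<^sub>j\<close> of squared length \<open>1/2\<close> is added to a triple of total \<open>2\<close>. Measured in
  the direction \<open>\<surd>2 w\<^sub>j\<close>, put \<open>h\<^sub>i = 2 det(w\<^sub>j, w\<^sub>i)\<^sup>2\<close>. The triple has second moment matrix \<open>I\<close>, so the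
  \<open>h\<^sub>i\<close> add up to \<open>1\<close>, and the conditions against \<open>w\<^sub>j\<close> are tight: \<open>|w\<^sub>i|\<^sup>2 = (1 + h\<^sub>i)/2\<close>. If all three
  are long, then every \<open>h\<^sub>i\<close> is positive, and tightness within the triple gives \<open>h\<^sub>i + h\<^sub>k = 1\<close> for each
  of the three pairs, hence total \<open>3/2\<close>.\<close>
lemma tight_triple_not_all_big:
  assumes card: "card T = 3" and j: "j \<notin> T" and spread_on: "spread_on (insert j T) x y"
    and tot: "(\<Sum>i\<in>T. sq_len x y i) = 2" and half: "sq_len x y j = 1/2"
    and big: "\<And>i. i \<in> T \<Longrightarrow> 1/2 < sq_len x y i"
  shows False
proof -
  have fT: "spread_on T x y" using spread_on by (auto simp: spread_on_def)
  note tight = spread_triple(2)[OF card fT tot]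
  obtain a b c where T: "T = {a, b, c}" and ne: "a \<noteq> b" "a \<noteq> c" "b \<noteq> c"
    using card card_3_iff by metis
  define h where "h i = 2 * (cross x y j i)\<^sup>2" for i
  define g where "g i = x i * x j + y i * y j" for i
  have lj: "(x j)\<^sup>2 + (y j)\<^sup>2 = 1/2" using half by (simp add: sq_len_def)
  have sumh: "h a + h b + h c = 1"
  proof -
    have "h a + h b + h c = 2 * ((x j)\<^sup>2 * (\<Sum>i\<in>T. (y i)\<^sup>2) + (y j)\<^sup>2 * (\<Sum>i\<in>T. (x i)\<^sup>2)
        - 2 * x j * y j * (\<Sum>i\<in>T. x i * y i))"
      using ne unfolding T h_def cross_def by (simp add: power2_eq_square algebra_simps)
    then show ?thesis using tight lj by simp
  qed
  have ge: "2 * sq_len x y i \<le> 1 + h i" if "i \<in> T" for i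
  proof -
    have "sq_len x y j + sq_len x y i \<le> 1 + (cross x y j i)\<^sup>2"
      using spread_on that j by (auto simp: spread_on_def)
    then show ?thesis using half by (simp add: h_def)
  qed
  have "sq_len x y a + sq_len x y b + sq_len x y c = 2" using tot ne by (simp add: T)
  then have eq: "2 * sq_len x y a = 1 + h a" "2 * sq_len x y b = 1 + h b" "2 * sq_len x y c = 1 + h c"
    using ge[of a] ge[of b] ge[of c] sumh by (auto simp: T)
  have lag: "sq_len x y i = 2 * (g i)\<^sup>2 + h i" for i
    using lj unfolding sq_len_def g_def h_def cross_def by algebra
  have two: "h i + h k = 1" if "i \<in> T" "k \<in> T" "i \<noteq> k"
      and e: "2 * sq_len x y i = 1 + h i" "2 * sq_len x y k = 1 + h k" for i k
  proof -
    have t: "sq_len x y i + sq_len x y k = 1 + (cross x y i k)\<^sup>2" using tight that by blast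
    have pos: "0 < h i" "0 < h k" using e big that by fastforce+
    define u v where "u = cross x y j i" and "v = cross x y j k"
    have hu: "h i = 2 * u\<^sup>2" "h k = 2 * v\<^sup>2" by (simp_all add: h_def u_def v_def)
    have un: "u \<noteq> 0" "v \<noteq> 0" using pos hu by auto
    have gi: "4 * (g i)\<^sup>2 = 1 - 2 * u\<^sup>2" using lag[of i] e hu by simp
    have gk: "4 * (g k)\<^sup>2 = 1 - 2 * v\<^sup>2" using lag[of k] e hu by simp
    have cr: "cross x y i k = 2 * (g i * v - g k * u)"
      using lj unfolding cross_def g_def u_def v_def by algebra
    \<comment> \<open>In the orthonormal frame with first vector \<open>\<surd>2 w\<^sub>j\<close> the two vectors are \<open>\<surd>2 (g i, u)\<close> and
      \<open>\<surd>2 (g k, v)\<close>; the equation is the tight pair condition in these coordinates.\<close>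
    have "u * v * (u * v + 2 * (g i * g k)) = 0"
    proof -
      have "u\<^sup>2 + v\<^sup>2 = (cross x y i k)\<^sup>2" using t e hu by simp
      then show ?thesis using gi gk unfolding cr by algebra
    qed
    then have "u * v = - 2 * (g i * g k)" using un by simp
    then have "4 * (u\<^sup>2 * v\<^sup>2) = (4 * (g i)\<^sup>2) * (4 * (g k)\<^sup>2)" by algebra
    then have "2 * u\<^sup>2 + 2 * v\<^sup>2 = 1" unfolding gi gk by algebra
    then show ?thesis using hu by simp
  qed
  have "h a + h b = 1" "h a + h c = 1" "h b + h c = 1"
    using two ne eq T by auto
  then show False using sumh by simp
qed

section \<open>Sums over consecutive angular gaps\<close>

lemma sorted_enumeration:
  fixes f :: "'i \<Rightarrow> real"
  assumes "finite J"
  shows "\<exists>e. bij_betw e {..<card J} J \<and> (\<forall>i j. i \<le> j \<longrightarrow> j < card J \<longrightarrow> f (e i) \<le> f (e j))"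
proof -
  obtain xs where xs: "set xs = J" "distinct xs"
    using assms finite_distinct_list by blast
  define ys where "ys = sort_key f xs"
  have ys: "set ys = J" "distinct ys" "sorted (map f ys)" "length ys = card J"
    using xs by (auto simp: ys_def distinct_card[symmetric])
  show ?thesis
  proof (intro exI[of _ "(!) ys"] conjI allI impI)
    show "bij_betw ((!) ys) {..<card J} J"
      using bij_betw_nth[OF ys(2) refl refl] ys by simp
    show "f (ys ! i) \<le> f (ys ! j)" if "i \<le> j" "j < card J" for i j
      using sorted_nth_mono[OF ys(3), of i j] that ys(4) by simp
  qed
qed

text \<open>Pair conditions bound sums over neighbours; this turns them into a bound on the whole sum, in
  which only the two end terms are missing once.\<close>
lemma sum_consecutive_pairs:
  fixes d :: "nat \<Rightarrow> real"
  shows "(\<Sum>i<m. d i + d (Suc i)) = 2 * (\<Sum>i\<le>m. d i) - d 0 - d m"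
  by (induction m) auto

text \<open>The largest possible sum of \<open>sin\<^sup>2\<close> over gaps of total \<open>D \<le> 2 \<pi>/3\<close>: up to \<open>\<pi>/2\<close> a single gap is
  best, beyond it two equal gaps, with \<open>2 sin\<^sup>2 (D/2) = 1 - cos D\<close>.\<close>
definition sin_gap_bound :: "real \<Rightarrow> real" where
  "sin_gap_bound D = (if D \<le> pi / 2 then (sin D)\<^sup>2 else 1 - cos D)"

lemma sin_gap_bound_step:
  assumes "0 \<le> D" "0 \<le> g" "D + g \<le> 2 * pi / 3"
  shows "sin_gap_bound D + (sin g)\<^sup>2 \<le> sin_gap_bound (D + g)"
proof -
  consider "D + g \<le> pi/2" | "D \<le> pi/2" "D + g > pi/2" | "D > pi/2" by linarith
  then show ?thesis
  proof cases
    case 1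
    have "(sin (D + g))\<^sup>2 - (sin D)\<^sup>2 - (sin g)\<^sup>2 = 2 * sin D * sin g * cos (D + g)"
      using sin_cos_squared_add[of D] sin_cos_squared_add[of g]
      unfolding sin_add cos_add by algebra
    moreover have "0 \<le> sin D" "0 \<le> sin g" "0 \<le> cos (D + g)"
      using 1 assms by (auto intro!: sin_ge_zero cos_ge_zero)
    ultimately show ?thesis using 1 assms by (simp add: sin_gap_bound_def)
        (smt (verit) mult_nonneg_nonneg)
  next
    case 2
    have "(sin D)\<^sup>2 + (sin g)\<^sup>2 = 1 - cos (D + g) * cos (D - g)"
      using sin_cos_squared_add[of D] sin_cos_squared_add[of g]
      unfolding cos_diff cos_add by algebra
    moreover have "cos (D + g) * 1 \<le> cos (D + g) * cos (D - g)"
    proof (rule mult_left_mono_neg)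
      show "cos (D + g) \<le> 0"
        using cos_monotone_0_pi_le[of "pi/2" "D+g"] 2 assms by simp
    qed simp
    ultimately show ?thesis using 2 by (simp add: sin_gap_bound_def)
  next
    case 3
    define h where "h = g / 2"
    have g: "g = 2 * h" by (simp add: h_def)
    have h: "0 \<le> h" "h \<le> pi / 12" using 3 assms by (auto simp: h_def)
    have e1: "cos D - cos (D + g) = 2 * sin (D + h) * sin h"
    proof -
      have "cos D = cos (D + h) * cos h + sin (D + h) * sin h"
        using cos_diff[of "D + h" h] by simp
      moreover have "cos (D + g) = cos (D + h) * cos h - sin (D + h) * sin h"
        using cos_add[of "D + h" h] by (simp add: g add.assoc)
      ultimately show ?thesis by simp
    qed
    have e2: "(sin g)\<^sup>2 = 2 * (sin g * cos h) * sin h"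
      using sin_double[of h] by (simp add: g power2_eq_square)
    have "sin g * cos h \<le> sin g * 1"
      using h by (intro mult_left_mono sin_ge_zero) (auto simp: g)
    also have "\<dots> \<le> sin (pi / 6)"
      using h by (simp add: g) (intro sin_monotone_2pi_le, auto)
    also have "\<dots> \<le> cos (pi/6)" by (simp add: sin_30 cos_30)
    also have "\<dots> \<le> cos (D + h - pi/2)"
      using 3 assms h by (intro cos_monotone_0_pi_le) (auto simp: g)
    also have "\<dots> = sin (D + h)" by (simp add: cos_diff)
    finally have "sin g * cos h \<le> sin (D + h)" .
    moreover have "0 \<le> sin h" using h by (intro sin_ge_zero) auto
    ultimately have "(sin g)\<^sup>2 \<le> cos D - cos (D + g)"
      unfolding e1 e2 by (intro mult_right_mono) auto
    then show ?thesis using 3 assms by (simp add: sin_gap_bound_def)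
  qed
qed

lemma sum_sin_squared_gaps_le:
  fixes al :: "nat \<Rightarrow> real"
  assumes "\<And>i. i < m \<Longrightarrow> al i \<le> al (Suc i)" and "al m - al 0 \<le> 2 * pi / 3"
  shows "al 0 \<le> al m \<and> (\<Sum>i<m. (sin (al (Suc i) - al i))\<^sup>2) \<le> sin_gap_bound (al m - al 0)"
  using assms
proof (induction m)
  case 0
  then show ?case by (simp add: sin_gap_bound_def)
next
  case (Suc m)
  have s: "al m \<le> al (Suc m)" using Suc.prems by simp
  have IH: "al 0 \<le> al m" "(\<Sum>i<m. (sin (al (Suc i) - al i))\<^sup>2) \<le> sin_gap_bound (al m - al 0)"
    using Suc.IH Suc.prems s by auto
  show ?case
    using sin_gap_bound_step[of "al m - al 0" "al (Suc m) - al m"] IH s Suc.prems(2) by auto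
qed

text \<open>Here \<open>d i\<close> is the excess of a long vector over \<open>1/2\<close>, \<open>al i\<close> its angle from the perpendicular of the
  pole after rescaling the ellipse to the unit disc, and \<open>k\<close> is one minus the squared length of the pole.
  The bound on a single excess keeps all angles within \<open>\<pi>/3\<close>, since \<open>k < 1/3\<close>. If the total angle is
  at most \<open>\<pi>/2\<close>, the neighbour bounds alone give \<open>k\<close>, strictly because interior vectors are counted twice.
  If it exceeds \<open>\<pi>/2\<close>, the neighbour bounds lose a multiple of \<open>- cos D\<close>, and the bounds on the two
  extreme vectors win back a larger multiple.\<close>
lemma sum_lt_of_large_pole:
  fixes al d :: "nat \<Rightarrow> real"
  assumes m: "2 \<le> m" and k: "0 < k" "k < 1/3"
    and mono: "\<And>i. i < m \<Longrightarrow> al i \<le> al (Suc i)"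
    and al: "\<And>i. i \<le> m \<Longrightarrow> - pi/2 < al i \<and> al i < pi/2"
    and pos: "\<And>i. i \<le> m \<Longrightarrow> 0 < d i"
    and single: "\<And>i. i \<le> m \<Longrightarrow> d i \<le> k - 1/2 + (1 - k) * (cos (al i))\<^sup>2"
    and pair: "\<And>i. i < m \<Longrightarrow> d i + d (Suc i) \<le> k * (sin (al (Suc i) - al i))\<^sup>2"
  shows "(\<Sum>i\<le>m. d i) < k"
proof -
  have bd: "- pi/3 < al i \<and> al i < pi/3" if "i \<le> m" for i
  proof -
    have "1/4 - k/4 < (1 - k) * (cos (al i))\<^sup>2"
      using single[OF that] pos[OF that] k(2) by linarith
    then have "(1 - k) * (1/4) < (1 - k) * (cos (al i))\<^sup>2" by simp
    then have "1/4 < (cos (al i))\<^sup>2" using k by (simp only: mult_less_cancel_left_pos)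
    then have "(1/2)\<^sup>2 < (cos (al i))\<^sup>2" by (simp add: power2_eq_square)
    moreover have "0 \<le> cos (al i)" using al[OF that] by (intro cos_ge_zero) auto
    ultimately have "1/2 < cos (al i)" by (rule power2_less_imp_less)
    then have "cos (pi/3) < cos \<bar>al i\<bar>" by (simp add: cos_60)
    then have "\<bar>al i\<bar> < pi/3"
      using cos_monotone_0_pi_le[of "pi/3" "\<bar>al i\<bar>"] al[OF that] by force
    then show ?thesis by auto
  qed
  define D where "D = al m - al 0"
  have D: "D \<le> 2 * pi/3" using bd[of 0] bd[of m] by (simp add: D_def)
  have ch: "al 0 \<le> al m" "(\<Sum>i<m. (sin (al (Suc i) - al i))\<^sup>2) \<le> sin_gap_bound D"
    using sum_sin_squared_gaps_le[of m al] mono D unfolding D_def by auto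
  have "(\<Sum>i<m. d i + d (Suc i)) \<le> (\<Sum>i<m. k * (sin (al (Suc i) - al i))\<^sup>2)"
    by (intro sum_mono pair) simp
  also have "\<dots> \<le> k * sin_gap_bound D"
    unfolding sum_distrib_left[symmetric] using ch k by simp
  finally have main: "2 * (\<Sum>i\<le>m. d i) - d 0 - d m \<le> k * sin_gap_bound D"
    by (simp add: sum_consecutive_pairs)
  show ?thesis
  proof (cases "D \<le> pi/2")
    case True
    have "sin_gap_bound D \<le> 1" using True by (simp add: sin_gap_bound_def abs_square_le_1)
    then have "k * sin_gap_bound D \<le> k" using k by simp
    moreover have "d 0 + d m < (\<Sum>i\<le>m. d i)"
    proof -
      have "(\<Sum>i\<in>{0,1,m}. d i) \<le> (\<Sum>i\<le>m. d i)"
        using m pos by (intro sum_mono2) (auto intro: less_imp_le)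
      then show ?thesis using m pos[of 1] by simp
    qed
    ultimately show ?thesis using main by linarith
  next
    case False
    have cD: "cos D < 0"
      using False D cos_monotone_0_pi[of "pi/2" D] pi_gt_zero by simp
    have "\<bar>al 0 + al m\<bar> < pi/3"
      using False bd[of 0] bd[of m] pi_gt_zero unfolding D_def by linarith
    then have "cos (pi/3) < cos \<bar>al 0 + al m\<bar>"
      by (intro cos_monotone_0_pi) auto
    then have c: "1/2 < cos (al 0 + al m)" by (simp add: cos_60)
    have "(cos (al 0))\<^sup>2 + (cos (al m))\<^sup>2 = 1 + cos (al 0 + al m) * cos D"
      using sin_cos_squared_add[of "al 0"] sin_cos_squared_add[of "al m"]
      unfolding D_def cos_diff cos_add by algebra
    then have "(1 - k) * (cos (al 0))\<^sup>2 + (1 - k) * (cos (al m))\<^sup>2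
        = (1 - k) * (1 + cos (al 0 + al m) * cos D)"
      by (simp add: distrib_left[symmetric])
    \<comment> \<open>The neighbour sum misses one copy of each end, and their sum falls short of \<open>k\<close> by at least
      \<open>(1 - k) cos (al 0 + al m) |cos D|\<close>, more than the excess \<open>k |cos D|\<close> of the neighbour bounds.\<close>
    then have ends: "d 0 + d m \<le> 2 * k - 1 + (1 - k) * (1 + cos (al 0 + al m) * cos D)"
      using single[of 0] single[of m] by simp
    have "(1 - k) * (1/2) < (1 - k) * cos (al 0 + al m)" 
      using c k by (intro mult_strict_left_mono) auto
    moreover have "k < (1 - k) * (1/2)" using k by simp
    ultimately have "0 < (1 - k) * cos (al 0 + al m) - k" by linarith
    then have "((1 - k) * cos (al 0 + al m) - k) * cos D < 0"
      using cD by (simp add: mult_less_0_iff)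
    then show ?thesis using main ends False
      by (simp add: sin_gap_bound_def algebra_simps)
  qed
qed

text \<open>Convexity of \<open>tan\<close> on \<open>[0, \<pi>/6]\<close>, where \<open>tan (\<pi>/6) = 1/\<surd>3\<close>.\<close>
lemma tan_le_chord_30:
  assumes "0 \<le> th" "th \<le> pi / 6"
  shows "tan th \<le> th * (6 / pi) * (1 / sqrt 3)"
proof -
  have cz: "cos z \<noteq> 0" if "z \<in> {0..pi/6}" for z
    using cos_gt_zero_pi[of z] that pi_gt_zero by (auto simp del: pi_gt_zero)
  have "convex_on {0..pi/6} tan"
  proof (rule convex_on_realI[where f' = "\<lambda>z. inverse ((cos z)\<^sup>2)"])
    fix z assume "z \<in> {0..pi/6}" then show "(tan has_real_derivative inverse ((cos z)\<^sup>2)) (at z)"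
      using cz by (intro DERIV_tan) auto
  next
    fix u v assume uv: "u \<in> {0..pi/6}" "v \<in> {0..pi/6}" "u \<le> v"
    have "0 < cos v" "cos v \<le> cos u"
      using uv cos_gt_zero_pi[of v] pi_gt_zero
      by (auto intro!: cos_monotone_0_pi_le simp del: pi_gt_zero)
    then show "inverse ((cos u)\<^sup>2) \<le> inverse ((cos v)\<^sup>2)"
      by (intro le_imp_inverse_le power_mono) auto
  qed auto
  from convex_onD[OF this, of "th * (6/pi)" 0 "pi/6"] assms
  show ?thesis by (simp add: tan_30 field_simps)
qed

text \<open>The hypothesis is \<open>2 \<surd>D / (1 + D) \<le> sin g\<close>, which for \<open>g \<le> \<pi>/2\<close> means \<open>D \<le> tan\<^sup>2 (g/2)\<close>. For
  \<open>g < \<pi>/3\<close> the convex function \<open>tan\<^sup>2 (g/2)\<close> lies below its chord \<open>g/\<pi>\<close>, which it meets at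
  \<open>g = \<pi>/3\<close> with the value \<open>1/3\<close>; for larger \<open>g\<close> the bound \<open>D \<le> 1/3\<close> suffices.\<close>
lemma pair_excess_le_gap:
  assumes D: "0 < D" "D \<le> 1/3" and g: "0 \<le> g"
    and le: "D \<le> ((1 + D) / 2)\<^sup>2 * (sin g)\<^sup>2" and ne: "g \<noteq> pi / 3"
  shows "D < g / pi"
proof (cases "g \<ge> pi/3")
  case True
  then have "1/3 < g / pi" using ne by (simp add: field_simps)
  then show ?thesis using D(2) by linarith
next
  case False
  define th where "th = arctan (sqrt D)"
  have th: "0 < th" "th \<le> pi/6"
  proof -
    show "0 < th" using D by (simp add: th_def)
    have "sqrt D \<le> sqrt (1/3)" using D by simp
    then have "sqrt D \<le> tan (pi/6)" by (simp add: tan_30 real_sqrt_divide)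
    then have "th \<le> arctan (tan (pi/6))" by (simp add: th_def arctan_le_iff)
    then show "th \<le> pi/6" by (subst (asm) arctan_tan) auto
  qed
  have tan: "tan th = sqrt D" by (simp add: th_def tan_arctan)
  have cth: "0 < cos th" using th by (intro cos_gt_zero_pi) auto
  have sg: "0 \<le> sin g" using g False by (intro sin_ge_zero) auto
  have "sqrt D \<le> (1 + D) / 2 * sin g"
  proof (rule real_le_lsqrt)
    show "0 \<le> (1 + D) / 2 * sin g" using sg D by simp
    show "D \<le> ((1 + D) / 2 * sin g)\<^sup>2" using le by (simp only: power_mult_distrib)
  qed
  moreover have "sin (2 * th) * (1 + D) = 2 * sqrt D"
  proof -
    have s: "sin th = sqrt D * cos th" using tan cth by (simp add: tan_def field_simps)
    have "(cos th)\<^sup>2 * (1 + D) = 1"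
      using sin_cos_squared_add[of th] D unfolding s by (simp add: power_mult_distrib algebra_simps)
    moreover have "sin (2 * th) * (1 + D) = 2 * sqrt D * ((cos th)\<^sup>2 * (1 + D))"
      by (simp add: sin_double s power2_eq_square)
    ultimately show ?thesis by simp
  qed
  ultimately have "sin (2 * th) * (1 + D) \<le> sin g * (1 + D)" by (simp add: algebra_simps)
  then have sin: "sin (2 * th) \<le> sin g" using D by simp
  have "2 * th \<le> g"
  proof (rule ccontr)
    assume "\<not> 2 * th \<le> g"
    then have "sin g < sin (2 * th)" using g th by (intro sin_monotone_2pi) auto
    then show False using sin by simp
  qed
  then have lt: "th < pi / 6" "2 * th \<le> g" using False by auto
  have "tan th < tan (pi/6)" using lt th by (intro tan_monotone) auto
  then have "tan th * tan th < tan (pi/6) * tan th"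
    using th cth tan D by (intro mult_strict_right_mono) auto
  also have "\<dots> \<le> 1 / sqrt 3 * (th * (6 / pi) * (1 / sqrt 3))"
    unfolding tan_30 using tan_le_chord_30 th by (intro mult_left_mono) auto
  also have "\<dots> = 2 * th / pi" by (simp add: field_simps)
  also have "\<dots> \<le> g / pi" using lt by (simp add: divide_right_mono)
  finally show ?thesis using tan D by simp
qed

text \<open>Equality in every gap would make all of them \<open>\<pi>/3\<close>, which leaves room for only three.\<close>
lemma cyclic_sum_lt_one:
  fixes be d :: "nat \<Rightarrow> real"
  assumes m: "4 \<le> m" and ends: "be m - be 0 = pi"
    and mono: "\<And>i. i < m \<Longrightarrow> be i \<le> be (Suc i)"
    and D: "\<And>i. i < m \<Longrightarrow> 0 < d i + d (Suc i)" "\<And>i. i < m \<Longrightarrow> d i + d (Suc i) \<le> 1/3"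
    and pair: "\<And>i. i < m \<Longrightarrow>
      d i + d (Suc i) \<le> ((1 + (d i + d (Suc i))) / 2)\<^sup>2 * (sin (be (Suc i) - be i))\<^sup>2"
  shows "(\<Sum>i<m. d i + d (Suc i)) < 1"
proof -
  have tot: "(\<Sum>i<m. (be (Suc i) - be i) / pi) = 1"
    using ends by (simp add: sum_divide_distrib[symmetric] sum_lessThan_telescope)
  have strict: "d i + d (Suc i) < (be (Suc i) - be i) / pi" if "i < m" "be (Suc i) - be i \<noteq> pi/3" for i
    using that mono[of i] D(1,2)[of i] pair[of i] by (intro pair_excess_le_gap) auto
  have weak: "d i + d (Suc i) \<le> (be (Suc i) - be i) / pi" if "i < m" for i
  proof (cases "be (Suc i) - be i = pi/3")
    case True
    then show ?thesis using D(2)[OF that] by (simp only: True) simp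
  next
    case False
    then show ?thesis using strict[OF that] by simp
  qed
  have "\<exists>i<m. be (Suc i) - be i \<noteq> pi/3"
  proof (rule ccontr)
    assume "\<not> ?thesis"
    then have "(\<Sum>i<m. (be (Suc i) - be i) / pi) = (\<Sum>i<m. 1/3)" by (intro sum.cong) auto
    then show False using tot m by simp
  qed
  then have "(\<Sum>i<m. d i + d (Suc i)) < (\<Sum>i<m. (be (Suc i) - be i) / pi)"
    using strict weak by (intro sum_strict_mono_ex1) auto
  then show ?thesis using tot by simp
qed

section \<open>All vectors long\<close>

text \<open>The angle of the line through \<open>(u, v)\<close> is measured from the second axis, so that it ranges over
  the open interval from \<open>-\<pi>/2\<close> to \<open>\<pi>/2\<close> as soon as the line is not the first axis.\<close>
lemma cross_squared_polar:
  fixes u v u' v' :: real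
  assumes "v \<noteq> 0" "v' \<noteq> 0"
  shows "(u * v' - u' * v)\<^sup>2
    = (u\<^sup>2 + v\<^sup>2) * (u'\<^sup>2 + v'\<^sup>2) * (sin (arctan (u / v) - arctan (u' / v')))\<^sup>2"
    and "v\<^sup>2 = (u\<^sup>2 + v\<^sup>2) * (cos (arctan (u / v)))\<^sup>2"
    and "u\<^sup>2 = (u\<^sup>2 + v\<^sup>2) * (sin (arctan (u / v)))\<^sup>2"
proof -
  have c: "cos (arctan z) \<noteq> 0" for z :: real by (simp add: cos_arctan_not_zero)
  have s: "u * cos (arctan (u / v)) = v * sin (arctan (u / v))" if "v \<noteq> 0" for u v :: real
    using tan_arctan[of "u / v"] c[of "u / v"] that by (simp add: tan_def field_simps)
  have len: "v\<^sup>2 = (u\<^sup>2 + v\<^sup>2) * (cos (arctan (u / v)))\<^sup>2" if "v \<noteq> 0" for u v :: real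
    using s[OF that, of u] sin_cos_squared_add[of "arctan (u / v)"] by algebra
  show "v\<^sup>2 = (u\<^sup>2 + v\<^sup>2) * (cos (arctan (u / v)))\<^sup>2" using len assms by blast
  show "u\<^sup>2 = (u\<^sup>2 + v\<^sup>2) * (sin (arctan (u / v)))\<^sup>2"
    using s[OF assms(1), of u] sin_cos_squared_add[of "arctan (u / v)"] by algebra
  define a b where "a = arctan (u / v)" and "b = arctan (u' / v')"
  have sa: "u * cos a = v * sin a" and sb: "u' * cos b = v' * sin b"
    using s assms by (simp_all add: a_def b_def)
  have prod: "v\<^sup>2 * v'\<^sup>2 = (u\<^sup>2 + v\<^sup>2) * (u'\<^sup>2 + v'\<^sup>2) * (cos a * cos b)\<^sup>2"
    using arg_cong2[OF len[OF assms(1), of u] len[OF assms(2), of u'], of "(*)"]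
    by (simp only: a_def[symmetric] b_def[symmetric] power_mult_distrib mult_ac)
  have "((u * v' - u' * v) * (cos a * cos b))\<^sup>2 = (v * v' * sin (a - b))\<^sup>2"
    using sa sb unfolding sin_diff by algebra
  also have "\<dots> = v\<^sup>2 * v'\<^sup>2 * (sin (a - b))\<^sup>2" by (simp add: power_mult_distrib)
  also have "\<dots> = ((u\<^sup>2 + v\<^sup>2) * (u'\<^sup>2 + v'\<^sup>2) * (sin (a - b))\<^sup>2) * (cos a * cos b)\<^sup>2"
    using prod by (simp add: mult_ac)
  finally have "(u * v' - u' * v)\<^sup>2 * (cos a * cos b)\<^sup>2
      = ((u\<^sup>2 + v\<^sup>2) * (u'\<^sup>2 + v'\<^sup>2) * (sin (a - b))\<^sup>2) * (cos a * cos b)\<^sup>2"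
    by (simp add: power_mult_distrib)
  moreover have "(cos a * cos b)\<^sup>2 \<noteq> 0" using c by (simp add: a_def b_def)
  ultimately show "(u * v' - u' * v)\<^sup>2
    = (u\<^sup>2 + v\<^sup>2) * (u'\<^sup>2 + v'\<^sup>2) * (sin (arctan (u / v) - arctan (u' / v')))\<^sup>2"
    by (simp only: mult_cancel_right a_def b_def) blast
qed

text \<open>The pole \<open>i0\<close> lies on the first axis. Its pair conditions read \<open>x\<^sup>2/k + y\<^sup>2 \<le> 1\<close> with \<open>k\<close> one
  minus its squared length; dividing the first coordinate by \<open>\<surd>k\<close> gives vectors in the unit disc,
  for which determinants are at most the sine of the angle.\<close>
lemma excess_sum_lt_large_pole:
  assumes fin: "finite J" and card: "3 \<le> card J" and i0: "i0 \<notin> J"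
    and spread_on: "spread_on (insert i0 J) x y" and y0: "y i0 = 0"
    and big: "\<And>i. i \<in> J \<Longrightarrow> 1/2 < sq_len x y i" and pole: "2/3 < sq_len x y i0"
  shows "(\<Sum>i\<in>J. sq_len x y i - 1/2) < 1 - sq_len x y i0"
proof -
  define k where "k = 1 - sq_len x y i0"
  have x0: "(x i0)\<^sup>2 = 1 - k" using y0 by (simp add: k_def sq_len_def)
  have k0: "0 \<le> k" "k < 1/3" using spread_on pole by (auto simp: k_def spread_on_def)
  have ell: "(x j)\<^sup>2 + k * (y j)\<^sup>2 \<le> k" if "j \<in> J" for j
  proof -
    have "sq_len x y i0 + sq_len x y j \<le> 1 + (cross x y i0 j)\<^sup>2"
      using spread_on that i0 by (auto simp: spread_on_def)
    moreover have "(cross x y i0 j)\<^sup>2 = (1 - k) * (y j)\<^sup>2"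
      by (simp add: cross_def y0 power_mult_distrib x0)
    ultimately show ?thesis by (simp add: sq_len_def y0 x0 algebra_simps)
  qed
  have pair0: "sq_len x y i + sq_len x y j \<le> 1 + (cross x y i j)\<^sup>2" if "i \<in> J" "j \<in> J" "i \<noteq> j" for i j
    using spread_on that by (auto simp: spread_on_def)
  obtain e0 where e0: "bij_betw e0 {..<card J} J"
    using ex_bij_betw_nat_finite[OF fin] by (auto simp: atLeast0LessThan)
  \<comment> \<open>For \<open>k = 0\<close> the ellipse is a segment, and two long parallel vectors violate the pair condition.\<close>
  have "k \<noteq> 0"
  proof
    assume "k = 0"
    then have z: "x j = 0" if "j \<in> J" for j using ell[OF that] by simp
    have "e0 0 \<in> J" "e0 1 \<in> J" "e0 0 \<noteq> e0 1"
      using e0 card inj_onD[of e0 "{..<card J}" 0 1] by (auto simp: bij_betw_def)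
    then show False
      using pair0[of "e0 0" "e0 1"] z big[of "e0 0"] big[of "e0 1"] by (simp add: cross_def)
  qed
  then have k: "0 < k" "k < 1/3" using k0 by auto
  define c where "c = sqrt k"
  have c: "0 < c" "c\<^sup>2 = k" using k by (auto simp: c_def)
  define u where "u j = x j / c" for j
  have xu: "x j = c * u j" for j using c by (simp add: u_def)
  have disc: "(u j)\<^sup>2 + (y j)\<^sup>2 \<le> 1" if "j \<in> J" for j
  proof -
    have "k * ((u j)\<^sup>2 + (y j)\<^sup>2) \<le> k * 1"
      using ell[OF that] by (simp add: xu power_mult_distrib c algebra_simps)
    then show ?thesis using k by simp
  qed
  have yn: "y j \<noteq> 0" if "j \<in> J" for j
  proof
    assume "y j = 0"
    then have "(x j)\<^sup>2 > 1/2" "(x j)\<^sup>2 \<le> k" using big[OF that] ell[OF that] by (auto simp: sq_len_def)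
    then show False using k by simp
  qed
  define al where "al j = arctan (u j / y j)" for j
  have single: "sq_len x y j - 1/2 \<le> k - 1/2 + (1 - k) * (cos (al j))\<^sup>2" if "j \<in> J" for j
  proof -
    have "sq_len x y j = k * (u j)\<^sup>2 + (y j)\<^sup>2"
      by (simp add: sq_len_def xu power_mult_distrib c)
    also have "\<dots> = ((u j)\<^sup>2 + (y j)\<^sup>2) * (k * (sin (al j))\<^sup>2 + (cos (al j))\<^sup>2)"
      using cross_squared_polar(2,3)[OF yn[OF that] yn[OF that], of "u j", folded al_def] by algebra
    also have "\<dots> \<le> 1 * (k * (sin (al j))\<^sup>2 + (cos (al j))\<^sup>2)"
      using disc[OF that] k by (intro mult_right_mono) auto
    also have "\<dots> = k + (1 - k) * (cos (al j))\<^sup>2"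
      using sin_cos_squared_add[of "al j"] by algebra
    finally show ?thesis by simp
  qed
  have pair: "(sq_len x y i - 1/2) + (sq_len x y j - 1/2) \<le> k * (sin (al j - al i))\<^sup>2"
    if "i \<in> J" "j \<in> J" "i \<noteq> j" for i j
  proof -
    have "(sq_len x y i - 1/2) + (sq_len x y j - 1/2) \<le> (cross x y i j)\<^sup>2"
      using pair0[OF that] by simp
    also have "\<dots> = k * (u j * y i - u i * y j)\<^sup>2"
      unfolding cross_def xu c(2)[symmetric] by algebra
    also have "\<dots> = k * (((u j)\<^sup>2 + (y j)\<^sup>2) * ((u i)\<^sup>2 + (y i)\<^sup>2) * (sin (al j - al i))\<^sup>2)"
      using cross_squared_polar(1)[OF yn[OF that(2)] yn[OF that(1)], of "u j" "u i"]
      by (simp add: al_def)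
    also have "\<dots> \<le> k * (1 * 1 * (sin (al j - al i))\<^sup>2)"
      using disc that k by (intro mult_left_mono mult_right_mono mult_mono) auto
    finally show ?thesis by simp
  qed
  obtain e where e: "bij_betw e {..<card J} J"
    and mono: "\<And>i j. i \<le> j \<Longrightarrow> j < card J \<Longrightarrow> al (e i) \<le> al (e j)"
    using sorted_enumeration[OF fin, of al] by blast
  define m where "m = card J - 1"
  have m: "2 \<le> m" "card J = Suc m" using card by (auto simp: m_def)
  have eJ: "e i \<in> J" if "i \<le> m" for i using e that m by (auto simp: bij_betw_def)
  have en: "e i \<noteq> e (Suc i)" if "i < m" for i
    using e that m inj_onD[of e "{..<card J}" i "Suc i"] by (auto simp: bij_betw_def)
  have "(\<Sum>i\<le>m. sq_len x y (e i) - 1/2) < k"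
  proof (rule sum_lt_of_large_pole[OF m(1) k, where al = "\<lambda>i. al (e i)"])
    show "al (e i) \<le> al (e (Suc i))" if "i < m" for i using mono that m by simp
    show "- pi / 2 < al (e i) \<and> al (e i) < pi / 2" if "i \<le> m" for i
      using arctan_bounded[of "u (e i) / y (e i)"] by (simp add: al_def)
    show "0 < sq_len x y (e i) - 1/2" if "i \<le> m" for i using big[OF eJ[OF that]] by simp
    show "sq_len x y (e i) - 1/2 \<le> k - 1/2 + (1 - k) * (cos (al (e i)))\<^sup>2" if "i \<le> m" for i
      using single[OF eJ[OF that]] .
    show "sq_len x y (e i) - 1/2 + (sq_len x y (e (Suc i)) - 1/2)
        \<le> k * (sin (al (e (Suc i)) - al (e i)))\<^sup>2" if "i < m" for i
      using pair[of "e i" "e (Suc i)"] eJ en that by simp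
  qed
  moreover have "(\<Sum>i\<le>m. sq_len x y (e i) - 1/2) = (\<Sum>i\<in>J. sq_len x y i - 1/2)"
    using sum.reindex_bij_betw[OF e, of "\<lambda>i. sq_len x y i - 1/2"] m
    by (simp add: lessThan_Suc_atMost)
  ultimately show ?thesis by (simp add: k_def)
qed

text \<open>The lines, sorted by angle, are closed up into a cycle by listing the pole at both ends, at the
  angles \<open>-\<pi>/2\<close> and \<open>\<pi>/2\<close>. The product of two squared lengths is bounded by the square of their mean,
  which expresses the determinant condition through the common excess of the pair.\<close>
lemma excess_sum_lt_all_small:
  assumes fin: "finite J" and card: "3 \<le> card J" and i0: "i0 \<notin> J"
    and spread_on: "spread_on (insert i0 J) x y" and y0: "y i0 = 0"
    and big: "\<And>i. i \<in> insert i0 J \<Longrightarrow> 1/2 < sq_len x y i"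
    and small: "\<And>i. i \<in> insert i0 J \<Longrightarrow> sq_len x y i \<le> 2/3"
  shows "(\<Sum>i\<in>J. sq_len x y i - 1/2) < 1 - sq_len x y i0"
proof -
  define dd where "dd i = sq_len x y i - 1/2" for i
  have pr: "dd i + dd j \<le> (cross x y i j)\<^sup>2" if "i \<in> insert i0 J" "j \<in> insert i0 J" "i \<noteq> j" for i j
    using spread_on that by (fastforce simp: spread_on_def dd_def)
  have amgm: "sq_len x y i * sq_len x y j \<le> ((1 + (dd i + dd j)) / 2)\<^sup>2" for i j
    using sum_squares_ge_zero[of "sq_len x y i - sq_len x y j" 0]
    by (simp add: dd_def power2_eq_square algebra_simps)
  have c0: "(cross x y i0 j)\<^sup>2 = sq_len x y i0 * (y j)\<^sup>2" for j
    by (simp add: cross_def sq_len_def y0 power_mult_distrib)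
  have yn: "y j \<noteq> 0" if "j \<in> J" for j
  proof
    assume "y j = 0"
    then show False using pr[of i0 j] c0[of j] big[of i0] big[of j] that i0 by (auto simp: dd_def)
  qed
  define al where "al j = arctan (x j / y j)" for j
  have polep: "dd i0 + dd j \<le> ((1 + (dd i0 + dd j)) / 2)\<^sup>2 * (cos (al j))\<^sup>2" if "j \<in> J" for j
  proof -
    have "dd i0 + dd j \<le> sq_len x y i0 * (y j)\<^sup>2" using pr[of i0 j] that i0 c0 by auto
    also have "\<dots> = sq_len x y i0 * sq_len x y j * (cos (al j))\<^sup>2"
      using cross_squared_polar(2)[OF yn[OF that] yn[OF that], of "x j"]
      by (simp add: sq_len_def al_def)
    also have "\<dots> \<le> ((1 + (dd i0 + dd j)) / 2)\<^sup>2 * (cos (al j))\<^sup>2"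
      by (intro mult_right_mono amgm) simp
    finally show ?thesis .
  qed
  have pair: "dd i + dd j \<le> ((1 + (dd i + dd j)) / 2)\<^sup>2 * (sin (al j - al i))\<^sup>2"
    if "i \<in> J" "j \<in> J" "i \<noteq> j" for i j
  proof -
    have "dd i + dd j \<le> (cross x y i j)\<^sup>2" using pr that by auto
    also have "\<dots> = (x j * y i - x i * y j)\<^sup>2" unfolding cross_def by algebra
    also have "\<dots> = sq_len x y j * sq_len x y i * (sin (al j - al i))\<^sup>2"
      using cross_squared_polar(1)[OF yn[OF that(2)] yn[OF that(1)], of "x j" "x i"]
      by (simp add: sq_len_def al_def)
    also have "\<dots> \<le> ((1 + (dd j + dd i)) / 2)\<^sup>2 * (sin (al j - al i))\<^sup>2"
      by (intro mult_right_mono amgm) simp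
    finally show ?thesis by (simp add: add.commute)
  qed
  obtain e where e: "bij_betw e {..<card J} J"
    and mono: "\<And>i j. i \<le> j \<Longrightarrow> j < card J \<Longrightarrow> al (e i) \<le> al (e j)"
    using sorted_enumeration[OF fin, of al] by blast
  define m where "m = card J - 1"
  have m: "2 \<le> m" "card J = Suc m" using card by (auto simp: m_def)
  have eJ: "e i \<in> J" if "i \<le> m" for i using e that m by (auto simp: bij_betw_def)
  have en: "e i \<noteq> e (Suc i)" if "i < m" for i
    using e that m inj_onD[of e "{..<card J}" i "Suc i"] by (auto simp: bij_betw_def)
  define be where "be = case_nat (- pi/2) (\<lambda>i. if i \<le> m then al (e i) else pi/2)"
  define d where "d = case_nat (dd i0) (\<lambda>i. if i \<le> m then dd (e i) else dd i0)"
  have bnd: "- pi/2 < al j" "al j < pi/2" for j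
    using arctan_bounded[of "x j / y j"] by (auto simp: al_def)
  have dpos: "0 < dd j \<and> dd j \<le> 1/6" if "j \<in> insert i0 J" for j
    using big[OF that] small[OF that] by (simp add: dd_def)
  have dpos': "0 < d i \<and> d i \<le> 1/6" for i
    using dpos eJ by (auto simp: d_def split: nat.split)
  have "(\<Sum>i<Suc (Suc m). d i + d (Suc i)) < 1"
  proof (rule cyclic_sum_lt_one[where be = be])
    show "4 \<le> Suc (Suc m)" using m by simp
    show "be (Suc (Suc m)) - be 0 = pi" by (simp add: be_def)
    show "be i \<le> be (Suc i)" if "i < Suc (Suc m)" for i
    proof (cases i)
      case 0
      then show ?thesis using bnd(1)[of "e 0"] by (simp add: be_def)
    next
      case (Suc j)
      then show ?thesis
        using that mono[of j "Suc j"] bnd(2)[of "e j"] m by (auto simp: be_def)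
    qed
    show "0 < d i + d (Suc i)" for i using dpos'[of i] dpos'[of "Suc i"] by simp
    show "d i + d (Suc i) \<le> 1/3" for i using dpos'[of i] dpos'[of "Suc i"] by simp
    show "d i + d (Suc i) \<le> ((1 + (d i + d (Suc i))) / 2)\<^sup>2 * (sin (be (Suc i) - be i))\<^sup>2"
      if "i < Suc (Suc m)" for i
    proof -
      have "i = 0 \<or> i = Suc m \<or> (\<exists>j<m. i = Suc j)" using that by (cases i) auto
      then consider "i = 0" | "i = Suc m" | j where "i = Suc j" "j < m" by blast
      then show ?thesis
      proof cases
        case 1
        then show ?thesis using polep[OF eJ[of 0]]
          by (simp add: be_def d_def sin_add)
      next
        case 2
        then show ?thesis using polep[OF eJ[of m]]
          by (simp add: be_def d_def sin_diff add.commute)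
      next
        case 3
        then show ?thesis using pair[of "e j" "e (Suc j)"] eJ[of j] eJ[of "Suc j"] en[of j]
          by (simp add: be_def d_def)
      qed
    qed
  qed
  moreover have "(\<Sum>i<Suc (Suc m). d i + d (Suc i)) = 2 * (\<Sum>i\<le>m. dd (e i)) + 2 * dd i0"
  proof -
    have "(\<Sum>i\<le>Suc (Suc m). d i) = dd i0 + (\<Sum>i\<le>m. dd (e i)) + dd i0"
      by (subst sum.atMost_Suc_shift) (simp add: d_def)
    then show ?thesis by (subst sum_consecutive_pairs) (simp add: d_def)
  qed
  moreover have "(\<Sum>i\<le>m. dd (e i)) = (\<Sum>i\<in>J. dd i)"
    using sum.reindex_bij_betw[OF e, of dd] m by (simp add: lessThan_Suc_atMost)
  ultimately show ?thesis by (simp add: dd_def)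
qed

text \<open>Rotating a suitable vector onto the first axis preserves lengths and determinants; it then serves
  as the pole. Any vector will do if no \<open>|w\<^sub>i|\<^sup>2\<close> exceeds \<open>2/3\<close>.\<close>
lemma sq_len_sum_lt_all_big:
  assumes fin: "finite A" and card: "4 \<le> card A" and spread_on: "spread_on A x y"
    and big: "\<And>i. i \<in> A \<Longrightarrow> 1/2 < sq_len x y i"
  shows "(\<Sum>i\<in>A. sq_len x y i) < (real (card A) + 1) / 2"
proof -
  obtain i0 where i0: "i0 \<in> A"
    and alt: "2/3 < sq_len x y i0 \<or> (\<forall>i\<in>A. sq_len x y i \<le> 2/3)"
  proof -
    have "A \<noteq> {}" using card by auto
    then show thesis using that by (meson ex_in_conv not_le)
  qed
  define J where "J = A - {i0}"
  have J: "finite J" "3 \<le> card J" "i0 \<notin> J" "insert i0 J = A" "card A = Suc (card J)"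
    using fin card i0 card_Suc_Diff1[OF fin i0] by (auto simp: J_def)
  define r where "r = sqrt (sq_len x y i0)"
  have r: "r \<noteq> 0" "r\<^sup>2 = sq_len x y i0" using big[OF i0] by (auto simp: r_def)
  define x' where "x' j = (x i0 * x j + y i0 * y j) / r" for j
  define y' where "y' j = (x i0 * y j - y i0 * x j) / r" for j
  have x': "r * x' j = x i0 * x j + y i0 * y j" and y': "r * y' j = x i0 * y j - y i0 * x j" for j
    using r by (simp_all add: x'_def y'_def)
  have r0: "sq_len x y i0 \<noteq> 0" using big[OF i0] by auto
  have len: "sq_len x' y' j = sq_len x y j" for j
  proof -
    have "sq_len x y i0 * sq_len x' y' j = (r * x' j)\<^sup>2 + (r * y' j)\<^sup>2"
      unfolding r(2)[symmetric] sq_len_def[of x' y'] by algebra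
    also have "\<dots> = sq_len x y i0 * sq_len x y j" unfolding x' y' sq_len_def by algebra
    finally show ?thesis using r0 by simp
  qed
  have crs: "cross x' y' i j = cross x y i j" for i j
  proof -
    have "sq_len x y i0 * cross x' y' i j = (r * x' i) * (r * y' j) - (r * x' j) * (r * y' i)"
      unfolding r(2)[symmetric] cross_def by algebra
    also have "\<dots> = sq_len x y i0 * cross x y i j"
      unfolding x' y' sq_len_def cross_def by algebra
    finally show ?thesis using r0 by simp
  qed
  have spread_on': "spread_on (insert i0 J) x' y'" using spread_on by (simp add: spread_on_def len crs J)
  have y0: "y' i0 = 0" by (simp add: y'_def)
  have "(\<Sum>i\<in>J. sq_len x' y' i - 1/2) < 1 - sq_len x' y' i0"
  proof (cases "2/3 < sq_len x y i0")
    case True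
    then show ?thesis
      using big J by (intro excess_sum_lt_large_pole[OF J(1-3) spread_on' y0]) (auto simp: len)
  next
    case False
    then show ?thesis
      using alt big J by (intro excess_sum_lt_all_small[OF J(1-3) spread_on' y0]) (auto simp: len)
  qed
  moreover have "(\<Sum>i\<in>A. sq_len x y i) = sq_len x y i0 + (\<Sum>i\<in>J. sq_len x y i)"
    using J by (metis sum.insert)
  moreover have "(\<Sum>i\<in>J. sq_len x y i - 1/2) = (\<Sum>i\<in>J. sq_len x y i) - real (card J) / 2"
    by (simp add: sum_subtractf)
  ultimately show ?thesis using J(5) unfolding len by simp
qed

section \<open>Two negative eigenvalues\<close>

text \<open>If equality held in the non-strict bound, a triple \<open>T\<close> containing all long vectors would have total
  \<open>2\<close>, and every other vector would have squared length \<open>1/2\<close>. Then \<open>T\<close> contains a vector that is not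
  long, and exchanging it for an outside vector gives another tight triple. Comparing the two second
  moment matrices, both equal to \<open>I\<close>, shows that all outside vectors are parallel to the exchanged one.
  So the second moment matrix of the whole family is \<open>I\<close> plus a matrix of rank one, and cannot have both
  eigenvalues above \<open>1\<close>.\<close>
lemma spread_trace_lt:
  assumes fin: "finite A" and n: "4 \<le> card A" and spread_on: "spread_on A x y"
    and a: "(\<Sum>i\<in>A. (x i)\<^sup>2) = a" "1 < a" and b: "(\<Sum>i\<in>A. (y i)\<^sup>2) = b" "1 < b"
    and orth: "(\<Sum>i\<in>A. x i * y i) = 0"
  shows "a + b < (real (card A) + 1) / 2"
proof (rule ccontr)
  assume contra: "\<not> a + b < (real (card A) + 1) / 2"
  define s where "s i = sq_len x y i" for i
  have tot: "(\<Sum>i\<in>A. s i) = a + b" using a b by (simp add: s_def sq_len_def sum.distrib)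
  have sub: "spread_on B x y" if "B \<subseteq> A" for B using spread_on that by (auto simp: spread_on_def)
  define B where "B = {i\<in>A. 1/2 < s i}"
  have B: "B \<subseteq> A" "finite B" using fin by (auto simp: B_def)
  have rest: "(\<Sum>i\<in>A - T. s i) \<le> (real (card A) - real (card T)) / 2"
    if "B \<subseteq> T" "T \<subseteq> A" for T
  proof -
    have "(\<Sum>i\<in>A - T. s i) \<le> (\<Sum>i\<in>A - T. 1/2)" using that by (intro sum_mono) (auto simp: B_def)
    then show ?thesis
      using that fin by (simp add: card_Diff_subset finite_subset card_mono of_nat_diff)
  qed
  have split: "(\<Sum>i\<in>A. s i) = (\<Sum>i\<in>T. s i) + (\<Sum>i\<in>A - T. s i)" if "T \<subseteq> A" for T
    using sum.subset_diff[OF that fin, of s] by simp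
  have cB: "card B \<le> 3"
  proof (rule ccontr)
    assume "\<not> card B \<le> 3"
    then have "(\<Sum>i\<in>B. s i) < (real (card B) + 1) / 2"
      unfolding s_def using B by (intro sq_len_sum_lt_all_big sub) (auto simp: B_def s_def)
    then show False using rest[of B] split[of B] B tot contra by simp
  qed
  obtain T where T: "B \<subseteq> T" "T \<subseteq> A" "card T = 3"
    using exists_subset_between[of B 3 A] cB n B fin by auto
  have finT: "finite T" using T fin finite_subset by blast
  have T2: "(\<Sum>i\<in>T. s i) = 2" and R: "(\<Sum>i\<in>A - T. s i) = (real (card A) - 3) / 2"
    using spread_triple(1)[OF T(3) sub[OF T(2)]] rest[OF T(1,2)] split[OF T(2)] tot contra T(3)
    by (auto simp: s_def)
  have half: "s j = 1/2" if j: "j \<in> A - T" for j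
  proof (rule ccontr)
    assume "s j \<noteq> 1/2"
    then have "(\<Sum>i\<in>A - T. s i) < (\<Sum>i\<in>A - T. 1/2)"
      using j T fin by (intro sum_strict_mono_ex1) (auto simp: B_def intro!: bexI[of _ j])
    then show False
      using R T fin finT n by (simp add: card_Diff_subset of_nat_diff)
  qed
  have "A - T \<noteq> {}" using T n finT card_mono[OF finT, of A] by auto
  then obtain j where j: "j \<in> A - T" by blast
  have "B \<noteq> T"
  proof
    assume BT: "B = T"
    show False
    proof (rule tight_triple_not_all_big[OF T(3), of j x y])
      show "j \<notin> T" "spread_on (insert j T) x y" using j T sub[of "insert j T"] by auto
      show "(\<Sum>i\<in>T. sq_len x y i) = 2" "sq_len x y j = 1/2" using T2 half[OF j] by (auto simp: s_def)
      show "1/2 < sq_len x y i" if "i \<in> T" for i using that BT by (auto simp: B_def s_def)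
    qed
  qed
  then obtain i where i: "i \<in> T" "s i \<le> 1/2" using T by (fastforce simp: B_def)
  have frame: "(\<Sum>k\<in>T. (x k)\<^sup>2) = 1" "(\<Sum>k\<in>T. (y k)\<^sup>2) = 1" "(\<Sum>k\<in>T. x k * y k) = 0"
    using spread_triple(2)[OF T(3) sub[OF T(2)]] T2 by (auto simp: s_def)
  have swap: "(x k)\<^sup>2 = (x i)\<^sup>2 \<and> (y k)\<^sup>2 = (y i)\<^sup>2 \<and> x k * y k = x i * y i" if k: "k \<in> A - T" for k
  proof -
    define U where "U = insert k (T - {i})"
    have U: "U \<subseteq> A" "card U = 3" using k T i finT by (auto simp: U_def card_Diff_singleton)
    have ex: "(\<Sum>l\<in>U. f l) = f k + ((\<Sum>l\<in>T. f l) - f i)" for f :: "'a \<Rightarrow> real"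
      using k i finT by (simp add: U_def sum_diff1)
    have "(\<Sum>l\<in>U. s l) \<ge> 2" unfolding ex using T2 half[OF k] i by simp
    then have "(\<Sum>l\<in>U. sq_len x y l) = 2"
      using spread_triple(1)[OF U(2) sub[OF U(1)]] by (simp add: s_def)
    from spread_triple(2)[OF U(2) sub[OF U(1)] this] show ?thesis
      unfolding ex frame by auto
  qed
  define m where "m = real (card (A - T))"
  have "(\<Sum>k\<in>A - T. f k) = m * f i" if "\<And>k. k \<in> A - T \<Longrightarrow> f k = f i" for f :: "'a \<Rightarrow> real"
    using that by (simp add: m_def)
  note const = this
  have "a = 1 + m * (x i)\<^sup>2"
    using sum.subset_diff[OF T(2) fin, of "\<lambda>k. (x k)\<^sup>2"] const[of "\<lambda>k. (x k)\<^sup>2"] swap a frame by simp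
  moreover have "b = 1 + m * (y i)\<^sup>2"
    using sum.subset_diff[OF T(2) fin, of "\<lambda>k. (y k)\<^sup>2"] const[of "\<lambda>k. (y k)\<^sup>2"] swap b frame by simp
  moreover have "m * (x i * y i) = 0"
  proof -
    have "(\<Sum>k\<in>A - T. x k * y k) = m * (x i * y i)" using const[of "\<lambda>k. x k * y k"] swap by blast
    then show ?thesis
      using sum.subset_diff[OF T(2) fin, of "\<lambda>k. x k * y k"] orth frame by linarith
  qed
  ultimately show False using a b by auto
qed

text \<open>The vectors \<open>(\<surd>(1 - s) u\<^sub>i, \<surd>(1 - t) v\<^sub>i)\<close>, with \<open>u\<close> and \<open>v\<close> orthonormal eigenvectors for \<open>s\<close> and
  \<open>t\<close>, have Gram matrix \<open>I - X\<close> and second moment matrix \<open>diag (1 - s, 1 - t)\<close>.\<close>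
lemma trace_lower_bound_negative:
  fixes k l :: "'n::finite"
  assumes n: "4 \<le> CARD('n)" and kl: "k \<noteq> l" and st: "s < 0" "t < 0"
    and mem: "two_spec k l s t \<in> eigenvalue_vectors S2"
  shows "(3 - real CARD('n)) / 2 < s + t"
proof -
  obtain X :: "real^'n^'n" where X: "X \<in> S2" and sim: "similar_matrix X (diag_matrix (two_spec k l s t))"
    using mem unfolding eigenvalue_vectors_def by blast
  have S: "transpose X = X" "\<And>i. 0 \<le> X$i$i" "\<And>i j. i \<noteq> j \<Longrightarrow> (X$i$j)\<^sup>2 \<le> X$i$i * X$j$j"
    using X mem_S2_iff[of X] n by auto
  obtain u v :: "real^'n" where uv: "u \<bullet> u = 1" "v \<bullet> v = 1" "u \<bullet> v = 0"
    and entry: "\<And>i j. X$i$j = (if i = j then 1 else 0) - (1 - s) * u$i * u$j - (1 - t) * v$i * v$j"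
    using spectral_form[OF kl S(1) _ _ sim] st by auto
  define p q where "p = sqrt (1 - s)" and "q = sqrt (1 - t)"
  have pq: "p\<^sup>2 = 1 - s" "q\<^sup>2 = 1 - t" using st by (simp_all add: p_def q_def)
  define x y where "x i = p * u$i" and "y i = q * v$i" for i
  have diag: "sq_len x y i = 1 - X$i$i" for i
    unfolding entry sq_len_def x_def y_def power_mult_distrib pq by (simp add: power2_eq_square)
  have off: "X$i$j = - (x i * x j + y i * y j)" if "i \<noteq> j" for i j
    unfolding entry x_def y_def pq[symmetric] using that by (simp add: power2_eq_square algebra_simps)
  have "spread_on UNIV x y"
    unfolding spread_on_def
  proof (intro conjI ballI impI)
    show "sq_len x y i \<le> 1" for i using S(2) diag by simp
    fix i j :: 'n assume ij: "i \<noteq> j"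
    have "(x i * x j + y i * y j)\<^sup>2 \<le> (1 - sq_len x y i) * (1 - sq_len x y j)"
      using S(3)[OF ij] unfolding off[OF ij] power2_minus by (simp add: diag)
    moreover have "(cross x y i j)\<^sup>2 = sq_len x y i * sq_len x y j - (x i * x j + y i * y j)\<^sup>2"
      unfolding cross_def sq_len_def by algebra
    ultimately show "sq_len x y i + sq_len x y j \<le> 1 + (cross x y i j)\<^sup>2"
      by (simp add: algebra_simps)
  qed
  moreover have "(\<Sum>i\<in>UNIV. (x i)\<^sup>2) = 1 - s"
  proof -
    have "(\<Sum>i\<in>UNIV. (x i)\<^sup>2) = p\<^sup>2 * (u \<bullet> u)"
      by (simp add: x_def inner_vec_def sum_distrib_left power_mult_distrib)
        (simp add: power2_eq_square)
    then show ?thesis using uv(1) pq by simp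
  qed
  moreover have "(\<Sum>i\<in>UNIV. (y i)\<^sup>2) = 1 - t"
  proof -
    have "(\<Sum>i\<in>UNIV. (y i)\<^sup>2) = q\<^sup>2 * (v \<bullet> v)"
      by (simp add: y_def inner_vec_def sum_distrib_left power_mult_distrib)
        (simp add: power2_eq_square)
    then show ?thesis using uv(2) pq by simp
  qed
  moreover have "(\<Sum>i\<in>UNIV. x i * y i) = 0"
  proof -
    have "(\<Sum>i\<in>UNIV. x i * y i) = p * q * (u \<bullet> v)"
      by (simp add: x_def y_def inner_vec_def sum_distrib_left mult_ac)
    then show ?thesis using uv(3) by simp
  qed
  ultimately have "(1 - s) + (1 - t) < (real CARD('n) + 1) / 2"
    using n st by (intro spread_trace_lt) auto
  then show ?thesis by (simp add: field_simps)
qed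

section \<open>The remaining signs, the minimizers and the conclusion\<close>

lemma trace_lower_bound_nonpos_prod:
  fixes k l :: "'n::finite"
  assumes n: "4 \<le> CARD('n)" and kl: "k \<noteq> l" and st: "s * t \<le> 0"
    and mem: "two_spec k l s t \<in> eigenvalue_vectors S2"
  shows "(3 - real CARD('n)) / 2 \<le> s + t"
    and "s + t = (3 - real CARD('n)) / 2 \<Longrightarrow> s = 0 \<or> t = 0"
proof -
  define N where "N = real CARD('n) - 2"
  have N: "2 \<le> N" using n by (simp add: N_def)
  have "s\<^sup>2 + t\<^sup>2 + N \<le> (s + t + N)\<^sup>2"
    using sum_squares_eigenvalues_le[OF _ mem] n
      sum_two_spec[OF kl, of "\<lambda>z. z\<^sup>2" s t] sum_two_spec[OF kl, of "\<lambda>z. z" s t]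
    by (simp add: N_def)
  moreover have "(s + t + N)\<^sup>2 = s\<^sup>2 + t\<^sup>2 + 2 * (s * t) + N * (2 * (s + t) + N)" by algebra
  ultimately have "N * (1 - N) - 2 * (s * t) \<le> N * (2 * (s + t))" by (simp add: algebra_simps)
  then have *: "- 2 * (s * t) \<le> N * (2 * (s + t) - (1 - N))" by (simp add: algebra_simps)
  then have "0 \<le> N * (2 * (s + t) - (1 - N))" using st by simp
  then have "0 \<le> 2 * (s + t) - (1 - N)" using N by (simp add: zero_le_mult_iff)
  then show "(3 - real CARD('n)) / 2 \<le> s + t" by (simp add: N_def)
  assume "s + t = (3 - real CARD('n)) / 2"
  then have "2 * (s + t) - (1 - N) = 0" by (simp add: N_def)
  then show "s = 0 \<or> t = 0" using * st by simp
qed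

text \<open>The matrix is \<open>0\<close> in position \<open>k\<close> and \<open>I - J/2\<close> on the remaining \<open>n - 1\<close> coordinates, with all its
  principal \<open>2 \<times> 2\<close> minors zero. The eigenvectors in the columns of \<open>P\<close> are the \<open>k\<close>-th
  unit vector, the sum of the other unit vectors (for the eigenvalue \<open>1 - (n - 1)/2\<close>), and differences
  of unit vectors (for the eigenvalue \<open>1\<close>).\<close>
lemma minimizer_mem:
  fixes k l :: "'n::finite"
  assumes n: "2 \<le> CARD('n)" and kl: "k \<noteq> l"
  shows "two_spec k l ((3 - real CARD('n)) / 2) 0 \<in> eigenvalue_vectors S2"
proof -
  define t where "t = (3 - real CARD('n)) / 2"
  define d where "d = two_spec k l t 0"
  define X :: "real^'n^'n" where
    "X = (\<chi> i j. if i = k \<or> j = k then 0 else if i = j then 1/2 else - 1/2)"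
  define P :: "real^'n^'n" where
    "P = (\<chi> i j. if j = k then (if i = k then 1 else 0) else if j = l then (if i = k then 0 else 1)
                 else (if i = j then 1 else if i = l then - 1 else 0))"
  have "X \<in> S2"
    unfolding mem_S2_iff[OF n] by (auto simp: X_def transpose_def vec_eq_iff power2_eq_square)
  have kerP: "w = 0" if w: "P *v w = 0" for w
  proof -
    have Pw: "(P *v w) $ i = (\<Sum>j\<in>UNIV. P$i$j * w$j)" for i
      by (simp add: matrix_vector_mult_def)
    have wk: "w$k = 0"
    proof -
      have "(P *v w) $ k = (\<Sum>j\<in>UNIV. if j = k then w$j else 0)"
        unfolding Pw using kl by (intro sum.cong) (auto simp: P_def)
      then show ?thesis using w by simp
    qed
    have wi: "w$i = - w$l" if i: "i \<noteq> k" "i \<noteq> l" for i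
    proof -
      have "(P *v w) $ i = (\<Sum>j\<in>UNIV. (if j = i then w$j else 0) + (if j = l then w$j else 0))"
        unfolding Pw using kl i by (intro sum.cong) (auto simp: P_def)
      then show ?thesis using w by (simp add: sum.distrib)
    qed
    have "(P *v w) $ l = (\<Sum>j\<in>UNIV. w$l - (if j = k then w$l else 0))"
      unfolding Pw using kl wi by (intro sum.cong) (auto simp: P_def)
    then have "(real CARD('n) - 1) * w$l = 0" using w by (simp add: sum_subtractf algebra_simps)
    then have "w$l = 0" using n by simp
    then show ?thesis using wk wi by (auto simp: vec_eq_iff) metis
  qed
  then have inv: "invertible P"
    unfolding invertible_left_inverse matrix_left_invertible_ker by blast
  have XP: "X ** P = P ** diag_matrix d"
  proof -
    have "(X ** P) $ i $ j = (P ** diag_matrix d) $ i $ j" for i j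
    proof -
      \<comment> \<open>Away from row \<open>k\<close>, applying \<open>X\<close> subtracts half the sum of the entries outside \<open>k\<close>.\<close>
      define c where "c = (\<Sum>m\<in>UNIV. if m = k then 0 else P$m$j)"
      have c: "c = (if j = l then real CARD('n) - 1 else 0)"
      proof -
        consider "j = k" | "j = l" "j \<noteq> k" | "j \<noteq> k" "j \<noteq> l" by blast
        then show ?thesis
        proof cases
          case 1
          then have "c = (\<Sum>m\<in>(UNIV::'n set). 0)" unfolding c_def by (intro sum.cong) (auto simp: P_def)
          then show ?thesis using 1 kl by simp
        next
          case 2
          then have "c = (\<Sum>m\<in>UNIV. 1 - (if m = k then 1 else 0))"
            unfolding c_def by (intro sum.cong) (auto simp: P_def)
          then show ?thesis using 2 by (simp add: sum_subtractf)
        next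
          case 3
          then have "c = (\<Sum>m\<in>UNIV. (if m = j then 1 else 0) - (if m = l then 1 else 0))"
            unfolding c_def using kl by (intro sum.cong) (auto simp: P_def)
          then show ?thesis using 3 by (simp add: sum_subtractf)
        qed
      qed
      have "(X ** P) $ i $ j = (if i = k then 0 else P$i$j - c / 2)"
      proof (cases "i = k")
        case True
        then show ?thesis by (simp add: matrix_matrix_mult_def X_def)
      next
        case False
        have "(X ** P) $ i $ j = (\<Sum>m\<in>UNIV. (if m = i then P$m$j else 0)
            - (if m = k then 0 else P$m$j) / 2)"
          unfolding matrix_matrix_mult_def using False
          by (simp, intro sum.cong) (auto simp: X_def)
        then show ?thesis using False by (simp add: sum_subtractf c_def sum_divide_distrib)
      qed
      also have "\<dots> = P$i$j * d$j"
        unfolding c d_def two_spec_def using kl by (auto simp: P_def t_def field_simps)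
      also have "\<dots> = (P ** diag_matrix d) $ i $ j"
        by (simp add: matrix_matrix_mult_def diag_matrix_def if_distrib cong: if_cong)
      finally show ?thesis .
    qed
    then show ?thesis by (simp add: vec_eq_iff)
  qed
  have "X = P ** diag_matrix d ** matrix_inv P"
    using XP matrix_inv_mult(1)[OF inv] by (metis matrix_mul_assoc matrix_mul_rid)
  then have "similar_matrix X (diag_matrix d)" using inv unfolding similar_matrix_def by blast
  then show ?thesis
    using \<open>X \<in> S2\<close> unfolding eigenvalue_vectors_def d_def t_def by blast
qed

theorem corollary3p13:
  assumes "CARD('n::{finite,linorder}) \<ge> 4"
  shows "{p. is_arg_min (\<lambda>(s, t). s + t) (\<lambda>p. p \<in> L2 TYPE('n)) p} =
           {(0, (3 - real CARD('n)) / 2), ((3 - real CARD('n)) / 2, 0)} \<and>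
         \<not> convex (L2 TYPE('n)) \<and>
         \<not> convex (eigenvalue_vectors S2 :: (real, 'n) vec set)"
proof -
  define m where "m = (3 - real CARD('n)) / 2"
  have m: "m < 0" using assms by (simp add: m_def)
  have n2: "2 \<le> CARD('n)" using assms by simp
  obtain k l :: 'n where kl: "k \<noteq> l" and ones: "\<And>s t. ones_then s t = two_spec k l s t"
    using ones_then_eq_two_spec[OF n2] by blast
  have L2: "(s, t) \<in> L2 TYPE('n) \<longleftrightarrow> two_spec k l s t \<in> eigenvalue_vectors S2" for s t
    by (simp add: L2_def ones)
  have bound: "m \<le> s + t" and eq: "s + t = m \<Longrightarrow> (s, t) = (0, m) \<or> (s, t) = (m, 0)"
    if "(s, t) \<in> L2 TYPE('n)" for s t
  proof -
    have mem: "two_spec k l s t \<in> eigenvalue_vectors S2" using that L2 by simp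
    have "m \<le> s + t \<and> (s + t = m \<longrightarrow> s = 0 \<or> t = 0)"
    proof (cases "s * t \<le> 0")
      case True
      then show ?thesis
        using trace_lower_bound_nonpos_prod[OF assms kl True mem] by (auto simp: m_def)
    next
      case False
      then consider "0 < s" "0 < t" | "s < 0" "t < 0" by (auto simp: not_le zero_less_mult_iff)
      then show ?thesis
      proof cases
        case 1
        then show ?thesis using m by simp
      next
        case 2
        then show ?thesis
          using trace_lower_bound_negative[OF assms kl 2 mem] by (simp add: m_def)
      qed
    qed
    then show "m \<le> s + t" "s + t = m \<Longrightarrow> (s, t) = (0, m) \<or> (s, t) = (m, 0)" by auto
  qed
  have mem: "(m, 0) \<in> L2 TYPE('n)" "(0, m) \<in> L2 TYPE('n)"
    using minimizer_mem[OF n2 kl] minimizer_mem[OF n2 kl[symmetric]] two_spec_swap[OF kl, of m 0]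
    by (auto simp: L2 m_def)
  have "{p. is_arg_min (\<lambda>(s, t). s + t) (\<lambda>p. p \<in> L2 TYPE('n)) p} = {(0, m), (m, 0)}"
  proof (intro set_eqI iffI)
    fix p assume "p \<in> {p. is_arg_min (\<lambda>(s, t). s + t) (\<lambda>p. p \<in> L2 TYPE('n)) p}"
    then obtain s t where p: "p = (s, t)" "(s, t) \<in> L2 TYPE('n)"
      and min: "\<And>q. q \<in> L2 TYPE('n) \<Longrightarrow> \<not> (case q of (s, t) \<Rightarrow> s + t) < s + t"
      by (cases p) (auto simp: is_arg_min_def)
    have "s + t = m" using min[OF mem(1)] bound[OF p(2)] by simp
    then show "p \<in> {(0, m), (m, 0)}" using eq[OF p(2)] p by auto
  next
    fix p assume "p \<in> {(0, m), (m, 0)}"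
    then show "p \<in> {p. is_arg_min (\<lambda>(s, t). s + t) (\<lambda>p. p \<in> L2 TYPE('n)) p}"
      using mem bound by (fastforce simp: is_arg_min_def)
  qed
  moreover have mid: "(m / 2, m / 2) \<notin> L2 TYPE('n)"
    using eq[of "m / 2" "m / 2"] m by auto
  have "\<not> convex (L2 TYPE('n))"
    using convexD[of "L2 TYPE('n)" "(m, 0)" "(0, m)" "1/2" "1/2"] mem mid by auto
  moreover have "\<not> convex (eigenvalue_vectors S2 :: (real, 'n) vec set)"
  proof
    assume conv: "convex (eigenvalue_vectors S2 :: (real, 'n) vec set)"
    have "(1/2) *\<^sub>R two_spec k l m 0 + (1/2) *\<^sub>R two_spec k l 0 m \<in> eigenvalue_vectors S2"
      using convexD[OF conv] mem by (simp add: L2)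
    moreover have "(1/2) *\<^sub>R two_spec k l m 0 + (1/2) *\<^sub>R two_spec k l 0 m = two_spec k l (m/2) (m/2)"
      using kl by (auto simp: two_spec_def vec_eq_iff)
    ultimately show False using mid by (simp add: L2)
  qed
  ultimately show ?thesis by (simp add: m_def)
qed

end
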